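(* Let $A$ be a finite alphabet of cardinality $N$, $X=A^{\mathbb{Z}_+}$, $n,k$ positive integers, $K=A^{[n]}$, $K^*=A^{[n+k]}$, and let $g$ be the shift-like map on $X$ associated with a map $\gamma:K^*\to K$. Let $\lambda_0=\sum_{s\in K}N^{-n}\lambda_s$, which is the $\frac1N$ Bernoulli measure on $X$, be the background measure. For each terminal $G$ basic set $B$ with associated $G^*$ basic set $B^*$, the measure $\lambda_B=\sum_{s\in B}v_B(s)\lambda_s$ is an ergodic $g$-invariant measure with support $H_\gamma(B^*_{G^*})$. With the measures $\{\lambda_B\}$ indexed by the terminal $G$ basic sets, the system $(X,g)$ is tractable.
   Context: $A^{[m]}$ is the set of words of length $m$; $J_m$ gives initial words of length $m$ (of sequences or longer words); $X=A^{\mathbb{Z}_+}$ has metric $d(x,y)=\inf\{1/(k+1):x_i=y_i\ \forall i<k\}$. The shift-like map is $g(s^*x)=\gamma(s^* )x$ for $s^*\in K^*$, $x\in X$. $J=J_n:K^*\to K$; $\bar J(s^* )$ is the terminal word of length $k$ of $s^*$. Relations: $(s,t)\in G$ iff $t=\gamma(s^* )$ for some $s^*$ with $J(s^* )=s$; $(s_1^*,s_2^* )\in G^*$ iff $J(s_2^* )=\gamma(s_1^* )$. For a relation $F$ on a finite set, $\mathcal{O}F=\bigcup_{n\ge1}F^n$, basic sets are classes of $\{s:(s,s)\in\mathcal{O}F\}$ under mutual $\mathcal{O}F$-reachability, terminal means $\mathcal{O}F(B)\subset B$; the $G^*$ basic set associated with a $G$ basic set $B$ is $B^*=\gamma^{-1}(B)\cap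 J^{-1}(B)$. $K^*_{G^*}$ is the space of sequences $\mathbf{s}^*$ in $K^*$ with consecutive pairs in $G^*$, $B^*_{G^*}=K^*_{G^*}\cap(B^* )^{\mathbb{Z}_+}$, and $H_\gamma(\mathbf{s}^* )=s^*_0\bar J(s^*_1)\bar J(s^*_2)\cdots$. For $s\in K$, $\lambda_s$ is the probability measure supported on the cylinder $\langle s\rangle=\{x:J_n(x)=s\}$ with $\lambda_s(\langle s\bar s_0\cdots\bar s_{p-1}\rangle)=N^{-pk}$ for $\bar s_j\in A^{[k]}$. $\Gamma$ is the stochastic matrix on $K$ with $\Gamma_{s_2s_1}=N^{-k}\,\#\{s^*:J(s^* )=s_1,\gamma(s^* )=s_2\}$, and for terminal $B$, $v_B$ is the unique distribution with $\Gamma v_B=v_B$ and support exactly $B$. Tractability of $(X,g)$ with respect to a full background measure $\lambda_0$: TRAC 1: $g$ has finitely many basic sets (chain components); TRAC 2: there are finitely many ergodic invariant probability measures $\mu_1,\dots,\mu_k$ such that every point outside a $\lambda_0$-null set is generic for some $\mu_i$ (generic: $\frac1n\sum_{i<n}u(g^ix)\to\int u\,d\mu_i$ for all continuous $u$); TRAC 3: each support $|\mu_i|$ is contained in a visible basic set (one with nonempty basin $\operatorname{int}\{x:\omega g(x)\subset B\}$); TRAC 4: for $i\ne j$, $\lambda_0(|\mu_i|\cap|\mu_j|)=0$. *)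

theory Defs
  imports "HOL-Probability.Probability"
begin

definition dX :: "(nat \<Rightarrow> 'a) \<Rightarrow> (nat \<Rightarrow> 'a) \<Rightarrow> real" where
  "dX x y = Inf {1 / real (k + 1) | k. \<forall>i<k. x i = y i}"

definition Xtop :: "(nat \<Rightarrow> 'a) topology" where
  "Xtop = Metric_space.mtopology UNIV dX"

text \<open>g(s* x) = gamma(s*) x, for s* of length n+k.\<close>
definition shiftlike :: "nat \<Rightarrow> nat \<Rightarrow> ('a list \<Rightarrow> 'a list) \<Rightarrow> (nat \<Rightarrow> 'a) \<Rightarrow> (nat \<Rightarrow> 'a)" where
  "shiftlike n k \<gamma> x =
     (\<lambda>i. if i < n then \<gamma> (map x [0..<n+k]) ! i else x (i + k))"

definition Kw :: "nat \<Rightarrow> 'a list set" where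
  "Kw m = {s. length s = m}"

definition Jn :: "nat \<Rightarrow> 'a list \<Rightarrow> 'a list" where "Jn n s = take n s"
definition Jbar :: "nat \<Rightarrow> 'a list \<Rightarrow> 'a list" where "Jbar n s = drop n s"

definition Grel :: "nat \<Rightarrow> nat \<Rightarrow> ('a list \<Rightarrow> 'a list) \<Rightarrow> ('a list \<times> 'a list) set" where
  "Grel n k \<gamma> = {(s, t). s \<in> Kw n \<and> t \<in> Kw n \<and>
       (\<exists>s'\<in>Kw (n+k). t = \<gamma> s' \<and> Jn n s' = s)}"

definition Gstar :: "nat \<Rightarrow> nat \<Rightarrow> ('a list \<Rightarrow> 'a list) \<Rightarrow> ('a list \<times> 'a list) set" where
  "Gstar n k \<gamma> = {(s1, s2). s1 \<in> Kw (n+k) \<and> s2 \<in> Kw (n+k) \<and> Jn n s2 = \<gamma> s1}"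

definition basic_set :: "('b \<times> 'b) set \<Rightarrow> 'b set \<Rightarrow> bool" where
  "basic_set F B \<longleftrightarrow> (\<exists>s. (s, s) \<in> F\<^sup>+ \<and> B = {t. (s, t) \<in> F\<^sup>+ \<and> (t, s) \<in> F\<^sup>+})"

definition terminal :: "('b \<times> 'b) set \<Rightarrow> 'b set \<Rightarrow> bool" where
  "terminal F B \<longleftrightarrow> F\<^sup>+ `` B \<subseteq> B"

definition assoc_star :: "nat \<Rightarrow> nat \<Rightarrow> ('a list \<Rightarrow> 'a list) \<Rightarrow> 'a list set \<Rightarrow> 'a list set" where
  "assoc_star n k \<gamma> B = {s. s \<in> Kw (n+k) \<and> \<gamma> s \<in> B \<and> Jn n s \<in> B}"

definition Kstar_seq :: "nat \<Rightarrow> nat \<Rightarrow> ('a list \<Rightarrow> 'a list) \<Rightarrow> (nat \<Rightarrow> 'a list) set" where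
  "Kstar_seq n k \<gamma> = {ss. (\<forall>i. ss i \<in> Kw (n+k)) \<and> (\<forall>i. (ss i, ss (Suc i)) \<in> Gstar n k \<gamma>)}"

definition Bstar_seq :: "nat \<Rightarrow> nat \<Rightarrow> ('a list \<Rightarrow> 'a list) \<Rightarrow> 'a list set \<Rightarrow> (nat \<Rightarrow> 'a list) set" where
  "Bstar_seq n k \<gamma> B = Kstar_seq n k \<gamma> \<inter> {ss. \<forall>i. ss i \<in> assoc_star n k \<gamma> B}"

text \<open>H_gamma(s*) = s*_0 Jbar(s*_1) Jbar(s*_2) ...\<close>
definition Hgam :: "nat \<Rightarrow> nat \<Rightarrow> (nat \<Rightarrow> 'a list) \<Rightarrow> (nat \<Rightarrow> 'a)" where
  "Hgam n k ss = (\<lambda>i. if i < n + k then ss 0 ! i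
      else Jbar n (ss ((i - (n+k)) div k + 1)) ! ((i - (n+k)) mod k))"

definition lam0 :: "(nat \<Rightarrow> 'a::finite) measure" where
  "lam0 = PiM UNIV (\<lambda>_. uniform_count_measure UNIV)"

definition lam_s :: "'a list \<Rightarrow> (nat \<Rightarrow> 'a::finite) measure" where
  "lam_s s = PiM UNIV (\<lambda>i. if i < length s then return (count_space UNIV) (s ! i)
                            else uniform_count_measure UNIV)"

definition Gamma :: "nat \<Rightarrow> nat \<Rightarrow> ('a::finite list \<Rightarrow> 'a list) \<Rightarrow> 'a list \<Rightarrow> 'a list \<Rightarrow> real" where
  "Gamma n k \<gamma> s2 s1 = real (card {t \<in> Kw (n+k). Jn n t = s1 \<and> \<gamma> t = s2}) / real CARD('a) ^ k"

definition vB :: "nat \<Rightarrow> nat \<Rightarrow> ('a::finite list \<Rightarrow> 'a list) \<Rightarrow> 'a list set \<Rightarrow> 'a list \<Rightarrow> real" where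
  "vB n k \<gamma> B = (THE v. (\<forall>s. 0 \<le> v s) \<and> {s. 0 < v s} = B \<and> (\<Sum>s\<in>Kw n. v s) = 1 \<and>
       (\<forall>s2\<in>Kw n. (\<Sum>s1\<in>Kw n. Gamma n k \<gamma> s2 s1 * v s1) = v s2))"

definition lamB :: "nat \<Rightarrow> nat \<Rightarrow> ('a::finite list \<Rightarrow> 'a list) \<Rightarrow> 'a list set \<Rightarrow> (nat \<Rightarrow> 'a) measure" where
  "lamB n k \<gamma> B = measure_of (space lam0) (sets lam0)
      (\<lambda>A. \<Sum>s\<in>B. ennreal (vB n k \<gamma> B s) * emeasure (lam_s s) A)"

definition invariant_measure :: "('b \<Rightarrow> 'b) \<Rightarrow> 'b measure \<Rightarrow> bool" where
  "invariant_measure g \<mu> \<longleftrightarrow> g \<in> measurable \<mu> \<mu> \<and> distr \<mu> \<mu> g = \<mu>"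

definition ergodic :: "('b \<Rightarrow> 'b) \<Rightarrow> 'b measure \<Rightarrow> bool" where
  "ergodic g \<mu> \<longleftrightarrow> (\<forall>A\<in>sets \<mu>. g -` A \<inter> space \<mu> = A \<longrightarrow> emeasure \<mu> A = 0 \<or> emeasure \<mu> A = 1)"

definition msupport :: "'b topology \<Rightarrow> 'b measure \<Rightarrow> 'b set" where
  "msupport T \<mu> = {x \<in> topspace T. \<forall>U. openin T U \<and> x \<in> U \<longrightarrow> emeasure \<mu> U > 0}"

definition generic :: "'b topology \<Rightarrow> ('b \<Rightarrow> 'b) \<Rightarrow> 'b measure \<Rightarrow> 'b \<Rightarrow> bool" where
  "generic T g \<mu> x \<longleftrightarrow> (\<forall>u. continuous_map T euclideanreal u \<longrightarrow>
      (\<lambda>n. (\<Sum>i<n. u ((g ^^ i) x)) / real n) \<longlonglongrightarrow> (\<integral>y. u y \<partial>\<mu>))"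

definition chain_rel :: "('b \<Rightarrow> 'b \<Rightarrow> real) \<Rightarrow> ('b \<Rightarrow> 'b) \<Rightarrow> ('b \<times> 'b) set" where
  "chain_rel d g = (\<Inter>e\<in>{e::real. 0 < e}. ({(x, g x) | x. True} O {(y, z). d y z < e})\<^sup>+)"

definition omega_limit :: "'b topology \<Rightarrow> ('b \<Rightarrow> 'b) \<Rightarrow> 'b \<Rightarrow> 'b set" where
  "omega_limit T g x = (\<Inter>m. T closure_of {(g ^^ i) x | i. m \<le> i})"

definition visible :: "'b topology \<Rightarrow> ('b \<Rightarrow> 'b) \<Rightarrow> 'b set \<Rightarrow> bool" where
  "visible T g B \<longleftrightarrow> T interior_of {x \<in> topspace T. omega_limit T g x \<subseteq> B} \<noteq> {}"

definition tractable :: "'b topology \<Rightarrow> ('b \<Rightarrow> 'b \<Rightarrow> real) \<Rightarrow> ('b \<Rightarrow> 'b) \<Rightarrow> 'b measure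
      \<Rightarrow> 'i set \<Rightarrow> ('i \<Rightarrow> 'b measure) \<Rightarrow> bool" where
  "tractable T d g lam I \<mu> \<longleftrightarrow>
     finite {B. basic_set (chain_rel d g) B} \<and>
     finite I \<and>
     (\<forall>i\<in>I. prob_space (\<mu> i) \<and> invariant_measure g (\<mu> i) \<and> ergodic g (\<mu> i)) \<and>
     (AE x in lam. \<exists>i\<in>I. generic T g (\<mu> i) x) \<and>
     (\<forall>i\<in>I. \<exists>C. basic_set (chain_rel d g) C \<and> visible T g C \<and> msupport T (\<mu> i) \<subseteq> C) \<and>
     (\<forall>i\<in>I. \<forall>j\<in>I. i \<noteq> j \<longrightarrow> emeasure lam (msupport T (\<mu> i) \<inter> msupport T (\<mu> j)) = 0)"

end

theory Submission
  imports Defs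
begin

text \<open>
  A terminal basic set \<open>B\<close> is never left, so \<open>H\<^sub>\<gamma>(B\<^sup>*\<^sub>G)\<close> is simply the clopen set of sequences whose initial word
  of length \<open>n\<close> lies in \<open>B\<close>, and \<open>\<lambda>\<^sub>B\<close> has density \<open>N\<^sup>n v\<^sub>B(J\<^sub>n x)\<close> with respect to \<open>\<lambda>\<^sub>0\<close>.
  Given the first \<open>n + jk\<close> letters of \<open>x\<close>, the point \<open>g\<^sup>j x\<close> is a known word of length \<open>n\<close> followed by
  fresh random letters. Hence for a cylinder function \<open>u\<close> the differences between \<open>u(g\<^sup>i x)\<close> and the mean
  of \<open>u\<close> given \<open>J\<^sub>n(g\<^sup>i x)\<close> are orthogonal as soon as their indices are far apart, and a second moment
  estimate along squares shows that their averages vanish almost surely; this takes the place of the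
  ergodic theorem. Applied to \<open>J\<^sub>n(g x)\<close> it says that every limit point of the empirical distributions
  of \<open>J\<^sub>n(g\<^sup>i x)\<close> is \<open>\<Gamma>\<close>-stationary. Supports of stationary distributions are closed under
  \<open>G\<close>, so the orbit must enter a terminal basic set \<open>B\<close>, and uniqueness of \<open>v\<^sub>B\<close> forces convergence to it.
  Existence of \<open>v\<^sub>B\<close>, genericity and ergodicity all follow.
\<close>

section \<open>Prefixes of sequences and words prepended to sequences\<close>

definition pre :: "nat \<Rightarrow> (nat \<Rightarrow> 'a) \<Rightarrow> 'a list" where
  "pre m x = map x [0..<m]"

definition conc :: "'a list \<Rightarrow> (nat \<Rightarrow> 'a) \<Rightarrow> nat \<Rightarrow> 'a" where
  "conc w y = (\<lambda>i. if i < length w then w ! i else y (i - length w))"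

lemma length_pre [simp]: "length (pre m x) = m"
  by (simp add: pre_def)

lemma nth_pre [simp]: "i < m \<Longrightarrow> pre m x ! i = x i"
  by (simp add: pre_def)

lemma pre_eq_iff: "pre m x = pre m y \<longleftrightarrow> (\<forall>i<m. x i = y i)"
  by (auto simp: list_eq_iff_nth_eq)

lemma pre_eq_list_iff: "pre m x = w \<longleftrightarrow> length w = m \<and> (\<forall>i<m. x i = w ! i)"
  by (auto simp: list_eq_iff_nth_eq)

lemma pre_eq_mono: "pre m x = pre m y \<Longrightarrow> l \<le> m \<Longrightarrow> pre l x = pre l y"
  by (simp add: pre_eq_iff)

lemma take_pre [simp]: "take l (pre m x) = pre (min l m) x"
  by (simp add: list_eq_iff_nth_eq)

lemma pre_conc_same [simp]: "pre (length w) (conc w y) = w"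
  by (simp add: pre_eq_list_iff conc_def)

lemma pre_conc_le: "m \<le> length w \<Longrightarrow> pre m (conc w y) = take m w"
  by (simp add: pre_eq_list_iff conc_def)

lemma conc_pre_shift: "conc (pre m x) (\<lambda>i. x (m + i)) = x"
  by (auto simp: conc_def)

lemma conc_append: "conc (v @ w) y = conc v (conc w y)"
  by (auto simp: conc_def nth_append fun_eq_iff)

text \<open>Identifies the library's splicing of two sequences with \<open>conc\<close> applied to a
  prefix, so that its invariance of product measures can be used.\<close>

lemma comb_seq_conc: "comb_seq m x y = conc (pre m x) y"
  by (auto simp: comb_seq_def conc_def fun_eq_iff)

lemma Kw_iff [simp]: "s \<in> Kw m \<longleftrightarrow> length s = m"
  by (simp add: Kw_def)

lemma finite_Kw [simp]: "finite (Kw m :: 'a::finite list set)"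
  using finite_lists_length_eq[of "UNIV :: 'a set" m] by (simp add: Kw_def)

section \<open>The Bernoulli measure\<close>

lemma prob_space_uniform: "prob_space (uniform_count_measure (UNIV :: 'a::finite set))"
  by (rule prob_space_uniform_count_measure) auto

interpretation bern: sequence_space "uniform_count_measure (UNIV :: 'a::finite set)"
  unfolding sequence_space_def product_prob_space_def product_prob_space_axioms_def product_sigma_finite_def
  by (simp add: prob_space_uniform prob_space_imp_sigma_finite)

lemma space_lam0 [simp]: "space lam0 = UNIV"
  by (simp add: lam0_def space_PiM space_uniform_count_measure)

lemma prob_space_lam0: "prob_space (lam0 :: (nat \<Rightarrow> 'a::finite) measure)"
  unfolding lam0_def by (rule bern.prob_space_axioms)

lemma sets_lam0: "sets (lam0 :: (nat \<Rightarrow> 'a::finite) measure) = sets (PiM UNIV (\<lambda>_. count_space UNIV))"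
  unfolding lam0_def by (intro sets_PiM_cong) (auto simp: sets_uniform_count_measure)

lemma measurable_lam0_cong:
  "measurable M lam0 = measurable M (PiM UNIV (\<lambda>_. count_space (UNIV::'a::finite set)))"
  "measurable lam0 N = measurable (PiM UNIV (\<lambda>_. count_space (UNIV::'a set))) N"
  by (auto intro!: measurable_cong_sets simp: sets_lam0)

lemma measurable_into_lam0:
  assumes "\<And>i. (\<lambda>x. f x i) \<in> measurable M (count_space UNIV)"
  shows "f \<in> measurable M (lam0 :: (nat \<Rightarrow> 'a::finite) measure)"
  unfolding measurable_lam0_cong
  by (intro measurable_PiM_single') (use assms in auto)

lemma measurable_coord [measurable]:
  "(\<lambda>x. x i) \<in> measurable (lam0 :: (nat \<Rightarrow> 'a::finite) measure) (count_space UNIV)"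
  unfolding measurable_lam0_cong by measurable

lemma measurable_pre [measurable]:
  "pre m \<in> measurable (lam0 :: (nat \<Rightarrow> 'a::finite) measure) (count_space UNIV)"
proof (rule measurable_count_space_eq_countable[THEN iffD2])
  show "pre m \<in> space lam0 \<rightarrow> UNIV \<and>
     (\<forall>w\<in>UNIV. pre m -` {w} \<inter> space (lam0 :: (nat \<Rightarrow> 'a) measure) \<in> sets lam0)"
  proof safe
    fix w :: "'a list"
    have "pre m -` {w} \<inter> space lam0 = {x\<in>space lam0. length w = m \<and> (\<forall>i\<in>{..<m}. x i = w ! i)}"
      by (auto simp: pre_eq_list_iff)
    also have "\<dots> \<in> sets lam0" by measurable
    finally show "pre m -` {w} \<inter> space (lam0 :: (nat \<Rightarrow> 'a) measure) \<in> sets lam0" .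
  qed auto
qed auto

lemma sets_cylinder: "{x :: nat \<Rightarrow> 'a::finite. pre m x = w} \<in> sets lam0"
proof -
  have "{x \<in> space lam0. pre m x = w} \<in> sets (lam0 :: (nat \<Rightarrow> 'a) measure)" by measurable
  then show ?thesis by simp
qed

lemma measurable_conc [measurable]:
  "conc w \<in> measurable (lam0 :: (nat \<Rightarrow> 'a::finite) measure) lam0"
proof (rule measurable_into_lam0)
  fix i show "(\<lambda>y. conc w y i) \<in> lam0 \<rightarrow>\<^sub>M count_space UNIV"
    by (cases "i < length w") (simp_all add: conc_def)
qed

lemma measurable_conc_pre:
  "(\<lambda>(x, y). conc (pre m x) y) \<in> measurable (lam0 \<Otimes>\<^sub>M lam0) (lam0 :: (nat \<Rightarrow> 'a::finite) measure)"
  using measurable_comb_seq[of m "uniform_count_measure (UNIV::'a set)"]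
  unfolding lam0_def comb_seq_conc .

text \<open>Resampling every letter from position \<open>m\<close> on by an independent copy
  preserves the law. All later conditioning on an initial word rests on this identity.\<close>

lemma distr_conc_pre:
  "distr (lam0 \<Otimes>\<^sub>M lam0) lam0 (\<lambda>(x, y). conc (pre m x) y) = (lam0 :: (nat \<Rightarrow> 'a::finite) measure)"
  using bern.PiM_comb_seq[of m, where 'a='a] unfolding lam0_def comb_seq_conc .

text \<open>Both measures agree on finite-dimensional boxes: the letters of \<open>w\<close>
  contribute factors 0 or 1, and the free coordinates are those of an independent sequence moved by
  \<open>length w\<close>. Integrals against \<open>lam_s\<close> thereby become integrals against
  \<open>lam0\<close>.\<close>

lemma lam_s_eq_distr: "lam_s w = distr lam0 lam0 (conc (w :: 'a::finite list))"
proof -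
  let ?M = "\<lambda>i. if i < length w then return (count_space UNIV) (w ! i)
                            else uniform_count_measure UNIV"
  have pM: "prob_space (?M i)" for i
    by (auto intro: prob_space_return prob_space_uniform)
  interpret P: product_prob_space ?M UNIV
    unfolding product_prob_space_def product_prob_space_axioms_def product_sigma_finite_def
    using pM prob_space_imp_sigma_finite by blast
  have "distr lam0 lam0 (conc w) = PiM UNIV ?M"
  proof (rule P.PiM_eq)
    show "sets (distr lam0 lam0 (conc w)) = sets (PiM UNIV ?M)"
      by (simp add: sets_lam0) (intro sets_PiM_cong, auto simp: sets_uniform_count_measure)
  next
    fix J and E :: "nat \<Rightarrow> 'a set"
    assume J: "finite J" "J \<subseteq> (UNIV::nat set)"
    let ?L = "length w"
    have emb: "prod_emb UNIV ?M J (Pi\<^sub>E J E) = {x. \<forall>j\<in>J. x j \<in> E j}"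
      by (auto simp: prod_emb_def space_uniform_count_measure restrict_def PiE_def Pi_def extensional_def)
    have meas: "{x. \<forall>j\<in>J. x j \<in> E j} \<in> sets (lam0 :: (nat \<Rightarrow> 'a) measure)"
    proof -
      have "{x \<in> space lam0. \<forall>j\<in>J. x j \<in> E j} \<in> sets (lam0 :: (nat \<Rightarrow> 'a) measure)"
        using J(1) by measurable
      thus ?thesis by simp
    qed
    define J' where "J' = {j\<in>J. ?L \<le> j}"
    have em: "emeasure lam0 {y \<in> space lam0. \<forall>j\<in>(\<lambda>j. j - ?L) ` J'. y j \<in> E (j + ?L)} =
        (\<Prod>j\<in>(\<lambda>j. j - ?L) ` J'. emeasure (uniform_count_measure UNIV) (E (j + ?L)))"
      unfolding lam0_def using J
      by (intro bern.emeasure_PiM_Collect[where X="\<lambda>j. E (j + ?L)"])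
        (auto simp: J'_def sets_uniform_count_measure)
    have "emeasure (distr lam0 lam0 (conc w)) {x. \<forall>j\<in>J. x j \<in> E j}
       = emeasure lam0 {y. \<forall>j\<in>J. conc w y j \<in> E j}"
      by (subst emeasure_distr[OF measurable_conc meas]) (simp add: vimage_def)
    also have "{y. \<forall>j\<in>J. conc w y j \<in> E j} = (if \<forall>j\<in>J. j < ?L \<longrightarrow> w ! j \<in> E j then
        {y \<in> space lam0. \<forall>j\<in>(\<lambda>j. j - ?L) ` J'. y j \<in> E (j + ?L)} else {})"
      by (auto simp: conc_def J'_def; force)
    also have "emeasure lam0 \<dots> = (if \<forall>j\<in>J. j < ?L \<longrightarrow> w ! j \<in> E j then
        (\<Prod>j\<in>(\<lambda>j. j - ?L) ` J'. emeasure (uniform_count_measure UNIV) (E (j + ?L))) else 0)"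
      by (simp only: em if_distrib[where f="emeasure lam0"] emeasure_empty)
    also have "(\<Prod>j\<in>(\<lambda>j. j - ?L) ` J'. emeasure (uniform_count_measure UNIV) (E (j + ?L)))
       = (\<Prod>j\<in>J'. emeasure (uniform_count_measure UNIV) (E j))"
      by (subst prod.reindex) (auto simp: inj_on_def J'_def)
    also have "(if \<forall>j\<in>J. j < ?L \<longrightarrow> w ! j \<in> E j then
        (\<Prod>j\<in>J'. emeasure (uniform_count_measure UNIV) (E j)) else 0) = (\<Prod>j\<in>J. emeasure (?M j) (E j))"
    proof (cases "\<forall>j\<in>J. j < ?L \<longrightarrow> w ! j \<in> E j")
      case True
      have "(\<Prod>j\<in>J. emeasure (?M j) (E j)) = (\<Prod>j\<in>J'. emeasure (?M j) (E j))"
        by (rule prod.mono_neutral_right) (use J True in \<open>auto simp: J'_def\<close>)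
      also have "\<dots> = (\<Prod>j\<in>J'. emeasure (uniform_count_measure UNIV) (E j))"
        by (rule prod.cong) (auto simp: J'_def)
      finally show ?thesis using True by simp
    next
      case False
      then have "(\<Prod>j\<in>J. emeasure (?M j) (E j)) = 0"
        using J(1) by (auto simp: prod_zero_iff indicator_def)
      with False show ?thesis by (simp only: if_False)
    qed
    finally show "emeasure (distr lam0 lam0 (conc w)) (prod_emb UNIV ?M J (Pi\<^sub>E J E)) = (\<Prod>j\<in>J. emeasure (?M j) (E j))"
      unfolding emb .
  qed
  thus ?thesis by (simp add: lam_s_def)
qed

lemma integrable_lam0_bounded:
  fixes u :: "(nat \<Rightarrow> 'a::finite) \<Rightarrow> real"
  assumes "u \<in> borel_measurable lam0" "\<And>x. \<bar>u x\<bar> \<le> C"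
  shows "integrable lam0 u"
  using prob_space.finite_measure[OF prob_space_lam0] assms
  by (intro finite_measure.integrable_const_bound[where B=C]) auto

text \<open>\<open>avg u s\<close> is the integral of \<open>u\<close> with respect to \<open>\<lambda>\<^sub>s\<close>.\<close>

definition avg :: "((nat \<Rightarrow> 'a::finite) \<Rightarrow> real) \<Rightarrow> 'a list \<Rightarrow> real" where
  "avg u s = (\<integral>y. u (conc s y) \<partial>lam0)"

text \<open>By Fubini applied to the resampling identity, \<open>avg u (pre m x)\<close> is the
  conditional expectation of \<open>u\<close> given the first \<open>m\<close> letters; this is the
  tower property.\<close>

lemma integral_conc_pre:
  fixes u :: "(nat \<Rightarrow> 'a::finite) \<Rightarrow> real"
  assumes [measurable]: "u \<in> borel_measurable lam0" and C: "\<And>x. \<bar>u x\<bar> \<le> C"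
  shows "(\<integral>x. u x \<partial>lam0) = (\<integral>x. avg u (pre m x) \<partial>lam0)"
proof -
  interpret prob_space "lam0 :: (nat \<Rightarrow> 'a) measure" by (rule prob_space_lam0)
  interpret pair_prob_space "lam0 :: (nat \<Rightarrow> 'a) measure" "lam0 :: (nat \<Rightarrow> 'a) measure" ..
  note [measurable] = measurable_conc_pre[of m]
  have "(\<integral>x. u x \<partial>lam0) = (\<integral>x. u x \<partial>distr (lam0 \<Otimes>\<^sub>M lam0) lam0 (\<lambda>(x, y). conc (pre m x) y))"
    by (simp add: distr_conc_pre)
  also have "\<dots> = (\<integral>(x, y). u (conc (pre m x) y) \<partial>(lam0 \<Otimes>\<^sub>M lam0))"
    by (subst integral_distr) (auto simp: measurable_conc_pre case_prod_unfold)
  also have "\<dots> = (\<integral>x. \<integral>y. u (conc (pre m x) y) \<partial>lam0 \<partial>lam0)"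
  proof (rule integral_fst'[symmetric, where f="\<lambda>(x,y). u (conc (pre m x) y)", simplified])
    have "(\<lambda>z. u ((\<lambda>(x, y). conc (pre m x) y) z)) \<in> borel_measurable (lam0 \<Otimes>\<^sub>M lam0)"
      by measurable
    then show "integrable (lam0 \<Otimes>\<^sub>M lam0) (\<lambda>(x, y). u (conc (pre m x) y))"
      using C by (intro P.integrable_const_bound[where B=C]) (auto simp: case_prod_unfold)
  qed
  finally show ?thesis by (simp add: avg_def)
qed

lemma measure_pre_eq:
  assumes "length w = m"
  shows "measure lam0 {x :: nat \<Rightarrow> 'a::finite. pre m x = w} = 1 / real CARD('a) ^ m"
proof -
  have "{x :: nat \<Rightarrow> 'a. pre m x = w} = {x\<in>space lam0. \<forall>i\<in>{..<m}. x i \<in> {w ! i}}"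
    using assms by (auto simp: pre_eq_list_iff)
  then have "emeasure lam0 {x :: nat \<Rightarrow> 'a. pre m x = w}
      = (\<Prod>i<m. emeasure (uniform_count_measure UNIV) {w ! i})"
    unfolding lam0_def by (simp only:) (rule bern.emeasure_PiM_Collect, auto simp: sets_uniform_count_measure)
  also have "\<dots> = (\<Prod>i<m. ennreal (1 / real CARD('a)))"
    by (simp add: emeasure_uniform_count_measure)
  also have "\<dots> = ennreal (1 / real CARD('a) ^ m)"
    by (simp add: ennreal_power power_one_over)
  finally show ?thesis
    by (simp add: measure_def)
qed

lemma integral_pre:
  fixes \<phi> :: "'a::finite list \<Rightarrow> real"
  shows "(\<integral>x. \<phi> (pre m x) \<partial>lam0) = (\<Sum>w\<in>Kw m. \<phi> w) / real CARD('a) ^ m"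
proof -
  interpret prob_space "lam0 :: (nat \<Rightarrow> 'a) measure" by (rule prob_space_lam0)
  have "(\<integral>x. \<phi> (pre m x) \<partial>lam0) = (\<integral>x. (\<Sum>w\<in>Kw m. \<phi> w * indicator {x. pre m x = w} x) \<partial>lam0)"
  proof (rule Bochner_Integration.integral_cong)
    fix x :: "nat \<Rightarrow> 'a"
    have "(\<Sum>w\<in>Kw m. \<phi> w * indicator {x. pre m x = w} x) = (\<Sum>w\<in>Kw m. if w = pre m x then \<phi> w else 0)"
      by (rule sum.cong) (auto simp: indicator_def)
    then show "\<phi> (pre m x) = (\<Sum>w\<in>Kw m. \<phi> w * indicator {x. pre m x = w} x)" by simp
  qed simp
  also have "\<dots> = (\<Sum>w\<in>Kw m. \<phi> w * measure lam0 {x. pre m x = w})"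
    by (subst Bochner_Integration.integral_sum) (auto simp: sets_cylinder less_top[symmetric] emeasure_eq_measure)
  also have "\<dots> = (\<Sum>w\<in>Kw m. \<phi> w / real CARD('a) ^ m)"
    by (rule sum.cong) (auto simp: measure_pre_eq)
  finally show ?thesis by (simp add: sum_divide_distrib)
qed

lemma abs_avg_le:
  fixes u :: "(nat \<Rightarrow> 'a::finite) \<Rightarrow> real"
  assumes [measurable]: "u \<in> borel_measurable lam0" and C: "\<And>x. \<bar>u x\<bar> \<le> C"
  shows "\<bar>avg u s\<bar> \<le> C"
proof -
  interpret prob_space "lam0 :: (nat \<Rightarrow> 'a) measure" by (rule prob_space_lam0)
  have "integrable lam0 (\<lambda>y. u (conc s y))"
    by (rule integrable_lam0_bounded[where C=C]) (use C in auto)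
  moreover have "AE y in lam0. norm (u (conc s y)) \<le> C" using C by simp
  ultimately have "norm (avg u s) \<le> C"
    unfolding avg_def by (intro order_trans[OF integral_norm_bound] integral_le_const integrable_norm)
  then show ?thesis by simp
qed

section \<open>Averages of finitely dependent sequences\<close>

text \<open>Between the last square \<open>r\<^sup>2\<close> and \<open>N\<close> there are at most
  \<open>2 * r\<close> further terms, each bounded by \<open>C\<close>, so passing from
  \<open>r\<^sup>2\<close> to \<open>N\<close> costs at most \<open>2 * C / r\<close>.\<close>

lemma square_subsequence_average:
  fixes d :: "nat \<Rightarrow> real"
  assumes d: "\<And>i. \<bar>d i\<bar> \<le> C"
    and lim: "(\<lambda>r. (\<Sum>i<r\<^sup>2. d i) / real (r\<^sup>2)) \<longlonglongrightarrow> 0"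
  shows "(\<lambda>N. (\<Sum>i<N. d i) / real N) \<longlonglongrightarrow> 0"
proof -
  define r where "r N = nat \<lfloor>sqrt (real N)\<rfloor>" for N
  have C0: "0 \<le> C" using d[of 0] by simp
  have r: "(r N)\<^sup>2 \<le> N" "N \<le> (r N)\<^sup>2 + 2 * r N" for N
  proof -
    have "real (r N) \<le> sqrt (real N)" "sqrt (real N) < real (r N) + 1"
      unfolding r_def by (auto simp: of_nat_floor)
    then have "real (r N) ^ 2 \<le> real N" "real N < (real (r N) + 1) ^ 2"
      by (metis of_nat_0_le_iff real_le_rsqrt real_sqrt_le_iff real_sqrt_pow2 power_mono real_sqrt_ge_zero)
        (metis \<open>sqrt (real N) < real (r N) + 1\<close> real_sqrt_less_iff real_sqrt_abs abs_of_nonneg of_nat_0_le_iff add_nonneg_nonneg zero_le_one)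
    then have "real ((r N)\<^sup>2) \<le> real N" "real N < real ((r N + 1)\<^sup>2)"
      by (simp_all add: add.commute)
    then have "(r N)\<^sup>2 \<le> N" "N < (r N + 1)\<^sup>2" by linarith+
    then show "(r N)\<^sup>2 \<le> N" "N \<le> (r N)\<^sup>2 + 2 * r N"
      by (simp_all add: power2_eq_square)
  qed
  have rlim: "filterlim r at_top sequentially"
  proof (rule filterlim_at_top[THEN iffD2], rule allI)
    fix Z
    have "Z \<le> r N" if "Z\<^sup>2 \<le> N" for N
      unfolding r_def using that
      by (metis le_nat_floor of_nat_mono of_nat_power real_le_rsqrt)
    then show "\<forall>\<^sub>F N in sequentially. Z \<le> r N"
      by (auto simp: eventually_sequentially)
  qed
  have l1: "(\<lambda>N. \<bar>(\<Sum>i<(r N)\<^sup>2. d i) / real ((r N)\<^sup>2)\<bar> + 2 * C / real (r N)) \<longlonglongrightarrow> \<bar>0\<bar> + 0"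
    by (intro tendsto_add tendsto_rabs filterlim_compose[OF lim rlim]
        filterlim_compose[OF lim_const_over_n rlim])
  have bd: "norm ((\<Sum>i<N. d i) / real N) \<le> \<bar>(\<Sum>i<(r N)\<^sup>2. d i) / real ((r N)\<^sup>2)\<bar> + 2 * C / real (r N)"
    if "0 < r N" for N
  proof -
    have N: "0 < N" using r(1)[of N] that by (metis gr0I le_zero_eq power_eq_0_iff less_irrefl)
    have "(\<Sum>i<N. d i) = (\<Sum>i<(r N)\<^sup>2. d i) + (\<Sum>i=(r N)\<^sup>2..<N. d i)"
      using sum.atLeastLessThan_concat[of 0 "(r N)\<^sup>2" N d] r(1)[of N] by (simp add: atLeast0LessThan)
    moreover have "\<bar>\<Sum>i=(r N)\<^sup>2..<N. d i\<bar> \<le> (\<Sum>i=(r N)\<^sup>2..<N. C)"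
      by (rule order_trans[OF sum_abs]) (intro sum_mono d)
    moreover have "(\<Sum>i=(r N)\<^sup>2..<N. C) = real (N - (r N)\<^sup>2) * C" by simp
    moreover have "real (N - (r N)\<^sup>2) * C \<le> real (2 * r N) * C"
      using r(2)[of N] C0 by (intro mult_right_mono) auto
    ultimately have "\<bar>\<Sum>i<N. d i\<bar> \<le> \<bar>\<Sum>i<(r N)\<^sup>2. d i\<bar> + 2 * real (r N) * C" by simp
    then have "\<bar>\<Sum>i<N. d i\<bar> / real N \<le> (\<bar>\<Sum>i<(r N)\<^sup>2. d i\<bar> + 2 * real (r N) * C) / real N"
      by (intro divide_right_mono) auto
    also have "\<dots> \<le> (\<bar>\<Sum>i<(r N)\<^sup>2. d i\<bar> + 2 * real (r N) * C) / real ((r N)\<^sup>2)"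
      using r(1)[of N] that N C0 by (intro divide_left_mono of_nat_mono mult_pos_pos) auto
    also have "\<dots> = \<bar>(\<Sum>i<(r N)\<^sup>2. d i) / real ((r N)\<^sup>2)\<bar> + 2 * C / real (r N)"
      using that by (simp add: field_simps power2_eq_square)
    finally show ?thesis by simp
  qed
  show ?thesis
  proof (rule Lim_null_comparison)
    show "\<forall>\<^sub>F N in sequentially. norm ((\<Sum>i<N. d i) / real N)
        \<le> \<bar>(\<Sum>i<(r N)\<^sup>2. d i) / real ((r N)\<^sup>2)\<bar> + 2 * C / real (r N)"
    proof (rule eventually_mono)
      show "\<forall>\<^sub>F N in sequentially. 1 \<le> r N"
        using rlim by (simp add: filterlim_at_top)
    qed (use bd in simp)
  qed (use l1 in simp)
qed

text \<open>Only pairs of indices closer than \<open>q\<close> contribute to the second moment of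
  the partial sums, which therefore grows at most linearly. Along squares the normalised second
  moments are of order \<open>1 / r\<^sup>2\<close>, hence summable; this gives convergence along
  squares, and boundedness fills the gaps.\<close>

lemma (in prob_space) AE_average_tendsto_0:
  fixes D :: "nat \<Rightarrow> 'a \<Rightarrow> real"
  assumes [measurable]: "\<And>i. D i \<in> borel_measurable M"
    and bnd: "\<And>i x. \<bar>D i x\<bar> \<le> C"
    and orth: "\<And>i j. i + q \<le> j \<Longrightarrow> expectation (\<lambda>x. D i x * D j x) = 0"
  shows "AE x in M. (\<lambda>N. (\<Sum>i<N. D i x) / real N) \<longlonglongrightarrow> 0"
proof -
  let ?S = "\<lambda>N x. \<Sum>i<N. D i x"
  have bnd2: "\<bar>D i x * D j x\<bar> \<le> C\<^sup>2" for i j x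
    unfolding abs_mult power2_eq_square using bnd[of i x] bnd[of j x] by (intro mult_mono) auto
  have int2: "integrable M (\<lambda>x. D i x * D j x)" for i j
    by (rule integrable_const_bound[where B="C\<^sup>2"]) (use bnd2 in auto)
  have le: "expectation (\<lambda>x. D i x * D j x) \<le> C\<^sup>2" for i j
    by (rule integral_le_const[OF int2]) (use bnd2[of i _ j] in \<open>auto simp: abs_le_iff\<close>)
  have E: "expectation (\<lambda>x. (?S N x)\<^sup>2) \<le> 2 * q * C\<^sup>2 * N" for N
  proof -
    have "expectation (\<lambda>x. (?S N x)\<^sup>2) = expectation (\<lambda>x. \<Sum>i<N. \<Sum>j<N. D i x * D j x)"
      by (simp add: power2_eq_square sum_product)
    also have "\<dots> = (\<Sum>i<N. \<Sum>j<N. expectation (\<lambda>x. D i x * D j x))"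
      by (simp add: Bochner_Integration.integral_sum int2)
    \<comment> \<open>Pairs outside this band are orthogonal, in one order or the other; the band
      has at most \<open>2 * q\<close> members, since truncated subtraction only shortens
      it.\<close>
    also have "\<dots> \<le> (\<Sum>i<N. \<Sum>j<N. if j \<in> {i - q..<i + q} then C\<^sup>2 else 0)"
    proof (intro sum_mono)
      fix i j
      show "expectation (\<lambda>x. D i x * D j x) \<le> (if j \<in> {i - q..<i + q} then C\<^sup>2 else 0)"
        using le[of i j] orth[of i j] orth[of j i] by (auto simp: mult.commute not_less not_le)
    qed
    also have "\<dots> \<le> (\<Sum>i<N. 2 * q * C\<^sup>2)"
    proof (intro sum_mono)
      fix i
      have "(\<Sum>j<N. if j \<in> {i - q..<i + q} then C\<^sup>2 else 0) = real (card ({..<N} \<inter> {i - q..<i + q})) * C\<^sup>2"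
        by (subst sum.inter_restrict[symmetric]) auto
      also have "card ({..<N} \<inter> {i - q..<i + q}) \<le> card {i - q..<i + q}"
        by (intro card_mono) auto
      then have "real (card ({..<N} \<inter> {i - q..<i + q})) * C\<^sup>2 \<le> real (2 * q) * C\<^sup>2"
        by (intro mult_right_mono of_nat_mono) auto
      finally show "(\<Sum>j<N. if j \<in> {i - q..<i + q} then C\<^sup>2 else 0) \<le> 2 * q * C\<^sup>2" by simp
    qed
    finally show ?thesis by (simp add: mult_ac)
  qed
  define Z where "Z r x = (?S (r\<^sup>2) x / real (r\<^sup>2))\<^sup>2" for r x
  have [measurable]: "Z r \<in> borel_measurable M" for r unfolding Z_def by measurable
  have C0: "0 \<le> C" using bnd[of 0 undefined] by linarith
  have Sb: "\<bar>?S N x\<bar> \<le> N * C" for N x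
    by (rule order_trans[OF sum_abs]) (use sum_mono[of "{..<N}" "\<lambda>i. \<bar>D i x\<bar>" "\<lambda>_. C"] bnd in auto)
  have intZ: "integrable M (\<lambda>x. (?S N x)\<^sup>2)" for N
  proof (rule integrable_const_bound[where B="(N * C)\<^sup>2"])
    show "AE x in M. norm ((?S N x)\<^sup>2) \<le> (N * C)\<^sup>2"
      using order_trans[OF Sb abs_ge_self] by (auto intro!: AE_I2 simp: abs_le_square_iff[symmetric])
  qed measurable
  have nnZ: "(\<integral>\<^sup>+x. Z r x \<partial>M) \<le> ennreal (2 * q * C\<^sup>2 * (1 / real r ^ 2))" for r
  proof -
    have eq: "Z r x = (?S (r\<^sup>2) x)\<^sup>2 / (real r ^ 2)^2" for x
      by (simp add: Z_def power_divide)
    have "(\<integral>\<^sup>+x. Z r x \<partial>M) = ennreal (expectation (Z r))"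
      by (rule nn_integral_eq_integral) (auto simp: eq intZ)
    also have "expectation (Z r) = expectation (\<lambda>x. (?S (r\<^sup>2) x)\<^sup>2) / (real r ^ 2)^2"
      unfolding eq by simp
    also have "\<dots> \<le> 2 * q * C\<^sup>2 * real (r\<^sup>2) / (real r ^ 2)^2"
      by (intro divide_right_mono E) auto
    also have "\<dots> = 2 * q * C\<^sup>2 * (1 / real r ^ 2)"
      by (simp add: power2_eq_square)
    finally show ?thesis by (simp add: ennreal_leI)
  qed
  \<comment> \<open>Exchanging sum and integral shows that the sum of all \<open>Z r\<close> has
    finite integral, hence is finite almost everywhere.\<close>
  have "(\<integral>\<^sup>+x. (\<Sum>r. ennreal (Z r x)) \<partial>M) = (\<Sum>r. \<integral>\<^sup>+x. Z r x \<partial>M)"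
    by (rule nn_integral_suminf) measurable
  also have "\<dots> \<le> (\<Sum>r. ennreal (2 * q * C\<^sup>2 * (1 / real r ^ 2)))"
    by (intro suminf_le nnZ) auto
  also have "\<dots> = ennreal (\<Sum>r. 2 * q * C\<^sup>2 * (1 / real r ^ 2))"
  proof (rule suminf_ennreal2)
    show "summable (\<lambda>r. 2 * q * C\<^sup>2 * (1 / real r ^ 2))"
      using inverse_power_summable[of 2, where 'a=real]
      by (intro summable_mult) (simp add: inverse_eq_divide)
  qed auto
  also have "\<dots> < \<infinity>" by simp
  finally have "AE x in M. (\<Sum>r. ennreal (Z r x)) \<noteq> \<infinity>"
    by (intro nn_integral_PInf_AE) auto
  then show ?thesis
  proof eventually_elim
    case (elim x)
    then have "summable (\<lambda>r. Z r x)"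
      by (intro summable_suminf_not_top) (auto simp: Z_def)
    then have "(\<lambda>r. Z r x) \<longlonglongrightarrow> 0" by (rule summable_LIMSEQ_zero)
    then have "(\<lambda>r. sqrt (Z r x)) \<longlonglongrightarrow> sqrt 0" by (rule tendsto_real_sqrt)
    then have "(\<lambda>r. \<bar>?S (r\<^sup>2) x / real (r\<^sup>2)\<bar>) \<longlonglongrightarrow> 0" by (simp only: Z_def real_sqrt_abs real_sqrt_zero)
    then have "(\<lambda>r. ?S (r\<^sup>2) x / real (r\<^sup>2)) \<longlonglongrightarrow> 0" by (rule tendsto_rabs_zero_cancel)
    then show ?case by (rule square_subsequence_average[OF bnd])
  qed
qed

section \<open>Shift-like maps\<close>

locale shift_like =
  fixes n k :: nat and \<gamma> :: "'a::finite list \<Rightarrow> 'a list"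
  assumes n_pos: "0 < n" and k_pos: "0 < k"
    and length_gamma: "length s = n + k \<Longrightarrow> length (\<gamma> s) = n"
begin

abbreviation "g \<equiv> shiftlike n k \<gamma>"

lemma g_conc:
  assumes "length s = n + k"
  shows "g (conc s y) = conc (\<gamma> s) y"
proof
  fix i
  have "map (conc s y) [0..<n + k] = s"
    using pre_conc_same[of s y] assms unfolding pre_def by simp
  then show "g (conc s y) i = conc (\<gamma> s) y i"
    using length_gamma[OF assms] assms by (auto simp: shiftlike_def conc_def)
qed

lemma g_eq_conc: "g x = conc (\<gamma> (pre (n + k) x)) (\<lambda>i. x (n + k + i))"
  using g_conc[of "pre (n + k) x" "\<lambda>i. x (n + k + i)"] conc_pre_shift[of "n + k" x] by simp

lemma pre_g: "pre n (g x) = \<gamma> (pre (n + k) x)"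
  using pre_conc_same[of "\<gamma> (pre (n + k) x)"] by (simp add: g_eq_conc length_gamma)

lemma g_tail: "n \<le> i \<Longrightarrow> g x i = x (i + k)"
  by (simp add: shiftlike_def)

lemma g_pow_tail: "n \<le> i \<Longrightarrow> (g ^^ j) x i = x (i + j * k)"
  by (induction j arbitrary: i) (auto simp: g_tail algebra_simps)

text \<open>Each application of \<open>g\<close> turns the first \<open>n + k\<close> letters into
  \<open>n\<close>, using up \<open>k\<close> letters of the word and leaving the tail
  \<open>y\<close> alone; after \<open>j\<close> steps a word of length \<open>n\<close> remains,
  the same for every tail.\<close>

lemma g_pow_conc:
  "length w = n + j * k \<Longrightarrow> \<exists>s. length s = n \<and> (\<forall>y. (g ^^ j) (conc w y) = conc s y)"
proof (induction j arbitrary: w)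
  case (Suc j)
  define w' where "w' = \<gamma> (take (n + k) w) @ drop (n + k) w"
  have "(g ^^ Suc j) (conc w y) = (g ^^ j) (conc w' y)" for y
  proof -
    have "conc w y = conc (take (n + k) w) (conc (drop (n + k) w) y)"
      by (simp flip: conc_append)
    then show ?thesis
      using Suc.prems by (simp add: funpow_Suc_right g_conc conc_append w'_def del: funpow.simps)
  qed
  moreover have "length w' = n + j * k"
    using Suc.prems by (simp add: w'_def length_gamma)
  ultimately show ?case using Suc.IH by metis
qed auto

text \<open>Markov structure: the remaining word is found by inserting the true tail of
  \<open>x\<close>. Given the first \<open>n + j * k\<close> letters, the leading word at time
  \<open>j\<close> is fixed and what follows it is fresh.\<close>

lemma g_pow_conc_pre:
  "(g ^^ j) (conc (pre (n + j * k) x) y) = conc (pre n ((g ^^ j) x)) y"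
proof -
  obtain s where s: "length s = n" "\<And>y. (g ^^ j) (conc (pre (n + j * k) x) y) = conc s y"
    using g_pow_conc[of "pre (n + j * k) x" j] by auto
  have "pre n ((g ^^ j) x) = s"
    using s(2)[of "\<lambda>i. x (n + j * k + i)"] pre_conc_same[of s] s(1) by (simp add: conc_pre_shift)
  then show ?thesis using s(2) by simp
qed

lemma g_nth: "g x i = (if i < n then \<gamma> (pre (n + k) x) ! i else x (i + k))"
  by (simp add: shiftlike_def pre_def)

text \<open>Since \<open>n \<le> m\<close>, the first \<open>m + k\<close> letters contain the whole
  word read by \<open>\<gamma>\<close>; every letter of the image from position \<open>n\<close> on
  is copied from \<open>k\<close> places to the right.\<close>

lemma pre_g_cong:
  assumes "n \<le> m" "pre (m + k) a = pre (m + k) b"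
  shows "pre m (g a) = pre m (g b)"
proof -
  have "pre (n + k) a = pre (n + k) b"
    by (rule pre_eq_mono[OF assms(2)]) (use assms(1) in simp)
  moreover have "a (i + k) = b (i + k)" if "i < m" for i
    using assms(2) that by (simp add: pre_eq_iff)
  ultimately have "g a i = g b i" if "i < m" for i
    using that by (simp add: g_nth)
  then show ?thesis by (simp add: pre_eq_iff)
qed

lemma pre_g_pow_cong:
  "n \<le> m \<Longrightarrow> pre (m + j * k) a = pre (m + j * k) b \<Longrightarrow> pre m ((g ^^ j) a) = pre m ((g ^^ j) b)"
proof (induction j arbitrary: a b)
  case (Suc j)
  have "pre (m + j * k) (g a) = pre (m + j * k) (g b)"
    by (rule pre_g_cong) (use Suc.prems in \<open>auto simp: algebra_simps\<close>)
  with Suc.prems(1) have "pre m ((g ^^ j) (g a)) = pre m ((g ^^ j) (g b))" by (rule Suc.IH)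
  then show ?case by (simp add: funpow_Suc_right del: funpow.simps)
qed simp

lemma measurable_g [measurable]: "g \<in> measurable lam0 lam0"
proof (rule measurable_into_lam0)
  fix i show "(\<lambda>x. g x i) \<in> lam0 \<rightarrow>\<^sub>M count_space UNIV"
  proof (cases "i < n")
    case True
    have "(\<lambda>x. \<gamma> (pre (n + k) x) ! i) \<in> lam0 \<rightarrow>\<^sub>M count_space UNIV" by measurable
    then show ?thesis using True by (simp add: g_nth)
  qed (simp add: g_nth)
qed

lemma measurable_g_pow [measurable]: "g ^^ j \<in> measurable lam0 lam0"
  by (rule measurable_compose_n) (rule measurable_g)

text \<open>Conditionally on the first \<open>n + j * k\<close> letters \<open>F\<close> is
  constant, while \<open>u\<close> at time \<open>j\<close> sees a known word followed by
  independent letters and so may be replaced by its mean given that word.\<close>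

lemma integral_conditional:
  assumes F [measurable]: "F \<in> borel_measurable lam0" and C: "\<And>x. \<bar>F x :: real\<bar> \<le> C"
    and dep: "\<And>x y. F (conc (pre (n + j * k) x) y) = F x"
    and u [measurable]: "u \<in> borel_measurable lam0" and C': "\<And>x. \<bar>u x :: real\<bar> \<le> C'"
  shows "(\<integral>x. F x * u ((g ^^ j) x) \<partial>lam0) = (\<integral>x. F x * avg u (pre n ((g ^^ j) x)) \<partial>lam0)"
proof -
  let ?h = "\<lambda>x. F x * u ((g ^^ j) x)"
  have "(\<integral>x. ?h x \<partial>lam0) = (\<integral>x. avg ?h (pre (n + j * k) x) \<partial>lam0)"
  proof (rule integral_conc_pre)
    show "\<bar>?h x\<bar> \<le> C * C'" for x
      unfolding abs_mult using C[of x] C'[of "(g ^^ j) x"] by (intro mult_mono) auto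
  qed measurable
  also have "(\<lambda>x. avg ?h (pre (n + j * k) x)) = (\<lambda>x. F x * avg u (pre n ((g ^^ j) x)))"
    by (simp add: avg_def dep g_pow_conc_pre)
  finally show ?thesis .
qed

text \<open>The next \<open>k\<close> letters are uniform, so the leading word moves from
  \<open>s\<close> to \<open>t\<close> with probability \<open>Gamma n k \<gamma> t s\<close>, and
  the letters after them are again fresh. This links the dynamics with the matrix \<Gamma>.\<close>

lemma avg_g:
  assumes u [measurable]: "u \<in> borel_measurable lam0" and C: "\<And>x. \<bar>u x :: real\<bar> \<le> C"
    and s: "length s = n"
  shows "avg (\<lambda>x. u (g x)) s = (\<Sum>t\<in>Kw n. Gamma n k \<gamma> t s * avg u t)"
proof -
  let ?h = "\<lambda>y. u (g (conc s y))"
  have card_eq: "card {w\<in>Kw k. \<gamma> (s @ w) = t} = card {w\<in>Kw (n+k). Jn n w = s \<and> \<gamma> w = t}" for t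
  proof (rule bij_betw_same_card[of "\<lambda>w. s @ w"])
    show "bij_betw ((@) s) {w\<in>Kw k. \<gamma> (s @ w) = t} {w\<in>Kw (n+k). Jn n w = s \<and> \<gamma> w = t}"
      by (rule bij_betwI[where g="drop n"]) (auto simp: s Jn_def)
  qed
  have "avg (\<lambda>x. u (g x)) s = (\<integral>y. ?h y \<partial>lam0)" by (simp add: avg_def)
  also have "\<dots> = (\<integral>y. avg ?h (pre k y) \<partial>lam0)"
    by (rule integral_conc_pre[where C=C]) (use C in auto)
  also have "(\<lambda>y. avg ?h (pre k y)) = (\<lambda>y. avg u (\<gamma> (s @ pre k y)))"
    using s by (simp add: avg_def g_conc flip: conc_append)
  also have "(\<integral>y. avg u (\<gamma> (s @ pre k y)) \<partial>lam0) = (\<Sum>w\<in>Kw k. avg u (\<gamma> (s @ w))) / real CARD('a) ^ k"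
    by (rule integral_pre)
  also have "(\<Sum>w\<in>Kw k. avg u (\<gamma> (s @ w))) =
      (\<Sum>t\<in>Kw n. \<Sum>w\<in>{w\<in>Kw k. \<gamma> (s @ w) = t}. avg u (\<gamma> (s @ w)))"
    by (rule sum.group[symmetric]) (auto simp: length_gamma s)
  also have "\<dots> = (\<Sum>t\<in>Kw n. real (card {w\<in>Kw k. \<gamma> (s @ w) = t}) * avg u t)"
    by (intro sum.cong) auto
  finally show ?thesis by (simp add: Gamma_def sum_divide_distrib card_eq del: Kw_iff)
qed

section \<open>Averages of conditionally centred cylinder functions along an orbit\<close>

definition cyl_average :: "nat \<Rightarrow> (nat \<Rightarrow> 'a) \<Rightarrow> nat \<Rightarrow> ('a list \<Rightarrow> real) \<Rightarrow> real" where
  "cyl_average N x m \<phi> = (\<Sum>i<N. \<phi> (pre m ((g ^^ i) x)) - avg (\<lambda>y. \<phi> (pre m y)) (pre n ((g ^^ i) x))) / real N"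

text \<open>Typicality of a point, reduced to one property valid off a single null set. What is used
  later about typical orbits follows deterministically from it.\<close>

definition good :: "(nat \<Rightarrow> 'a) \<Rightarrow> bool" where
  "good x \<longleftrightarrow> (\<forall>m \<phi>. (\<lambda>N. cyl_average N x m \<phi>) \<longlonglongrightarrow> 0)"

lemma bounded_on_pre: "\<exists>C. \<forall>x. \<bar>\<phi> (pre m x :: 'a list)\<bar> \<le> (C::real)"
proof -
  have "bdd_above ((\<lambda>w. \<bar>\<phi> w\<bar>) ` Kw m)" by (intro bdd_above_finite) auto
  then obtain C where "\<forall>w\<in>Kw m. \<bar>\<phi> w\<bar> \<le> C" unfolding bdd_above_def by auto
  then show ?thesis by (intro exI[of _ C]) simp
qed

text \<open>The term \<open>D i\<close> is determined by the first \<open>max n m + i * k\<close>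
  letters. For \<open>j\<close> far beyond \<open>i\<close>, conditioning on the first
  \<open>n + j * k\<close> letters makes \<open>D j\<close> average to zero, whence
  orthogonality.\<close>

lemma AE_cyl_average:
  "AE x in lam0. (\<lambda>N. cyl_average N x m \<phi>) \<longlonglongrightarrow> 0"
proof -
  interpret prob_space "lam0 :: (nat \<Rightarrow> 'a) measure" by (rule prob_space_lam0)
  obtain C where C: "\<And>x. \<bar>\<phi> (pre m x)\<bar> \<le> C" using bounded_on_pre[of \<phi> m] by auto
  let ?u = "\<lambda>y. \<phi> (pre m y)"
  have [measurable]: "?u \<in> borel_measurable lam0" by measurable
  have uC: "\<bar>avg ?u s\<bar> \<le> C" for s by (rule abs_avg_le) (use C in auto)
  define D where "D i x = ?u ((g ^^ i) x) - avg ?u (pre n ((g ^^ i) x))" for i x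
  have [measurable]: "D i \<in> borel_measurable lam0" for i unfolding D_def by measurable
  have DC: "\<bar>D i x\<bar> \<le> 2 * C" for i x
    unfolding D_def using C[of "(g ^^ i) x"] uC[of "pre n ((g ^^ i) x)"] by linarith
  have "AE x in lam0. (\<lambda>N. (\<Sum>i<N. D i x) / real N) \<longlonglongrightarrow> 0"
  \<comment> \<open>The gap \<open>m\<close> suffices: \<open>m \<le> m * k\<close>, so
    \<open>i + m \<le> j\<close> yields \<open>max n m + i * k \<le> n + j * k\<close>.\<close>
  proof (rule AE_average_tendsto_0[where q="m" and C="2 * C"])
    fix i j assume ij: "i + m \<le> j"
    have dep: "D i (conc (pre (n + j * k) x) y) = D i x" for x y
    proof -
      let ?z = "conc (pre (n + j * k) x) y"
      have mk: "m \<le> m * k" using k_pos by simp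
      have "i * k + m \<le> j * k"
        using mult_le_mono1[OF ij, of k, unfolded add_mult_distrib] mk by linarith
      then have "max n m + i * k \<le> n + j * k" by linarith
      then have "pre (max n m + i * k) ?z = pre (max n m + i * k) x"
        by (simp add: pre_conc_le)
      then have eq: "pre (max n m) ((g ^^ i) ?z) = pre (max n m) ((g ^^ i) x)"
        by (rule pre_g_pow_cong[rotated]) simp
      have "pre n ((g ^^ i) ?z) = pre n ((g ^^ i) x)" "pre m ((g ^^ i) ?z) = pre m ((g ^^ i) x)"
        by (rule pre_eq_mono[OF eq], simp)+
      then show ?thesis by (simp add: D_def)
    qed
    have C2: "0 \<le> 2 * C" by (rule order_trans[OF abs_ge_zero DC])
    have i1: "integrable lam0 (\<lambda>x. D i x * ?u ((g ^^ j) x))"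
     by (rule integrable_lam0_bounded[where C="2 * C * C"])
       (measurable, unfold abs_mult, rule mult_mono[OF DC C C2 abs_ge_zero])
    have i2: "integrable lam0 (\<lambda>x. D i x * avg ?u (pre n ((g ^^ j) x)))"
     by (rule integrable_lam0_bounded[where C="2 * C * C"])
       (measurable, unfold abs_mult, rule mult_mono[OF DC uC C2 abs_ge_zero])
    have "(\<integral>x. D i x * D j x \<partial>lam0) =
        (\<integral>x. D i x * ?u ((g ^^ j) x) - D i x * avg ?u (pre n ((g ^^ j) x)) \<partial>lam0)"
      by (simp only: D_def[of j] right_diff_distrib)
    also have "\<dots> = (\<integral>x. D i x * ?u ((g ^^ j) x) \<partial>lam0) - (\<integral>x. D i x * avg ?u (pre n ((g ^^ j) x)) \<partial>lam0)"
      by (rule Bochner_Integration.integral_diff[OF i1 i2])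
    also have "\<dots> = 0"
    proof -
      have "(\<integral>x. D i x * ?u ((g ^^ j) x) \<partial>lam0) = (\<integral>x. D i x * avg ?u (pre n ((g ^^ j) x)) \<partial>lam0)"
        by (rule integral_conditional[OF _ DC dep _ C]) measurable
      then show ?thesis by simp
    qed
    finally show "expectation (\<lambda>x. D i x * D j x) = 0" .
  qed (measurable, rule DC)
  then show ?thesis by (simp add: cyl_average_def D_def)
qed

text \<open>There are uncountably many \<open>\<phi>\<close>, but on words of length
  \<open>m\<close> each is a finite combination of point indicators; this reduces
  \<open>good\<close> to countably many almost sure statements.\<close>

lemma cyl_average_linear:
  "cyl_average N x m \<phi> = (\<Sum>w\<in>Kw m. \<phi> w * cyl_average N x m (\<lambda>v. of_bool (v = w)))"
proof -
  have *: "\<phi> (pre m y) = (\<Sum>w\<in>Kw m. \<phi> w * of_bool (pre m y = w))" for y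
  proof -
    have "(\<Sum>w\<in>Kw m. \<phi> w * of_bool (pre m y = w)) = (\<Sum>w\<in>Kw m. if w = pre m y then \<phi> w else 0)"
      by (intro sum.cong) auto
    then show ?thesis by simp
  qed
  have a: "avg (\<lambda>y. \<phi> (pre m y)) s = (\<Sum>w\<in>Kw m. \<phi> w * avg (\<lambda>y. of_bool (pre m y = w)) s)" for s
  proof -
    have "avg (\<lambda>y. \<phi> (pre m y)) s = (\<integral>y. (\<Sum>w\<in>Kw m. \<phi> w * of_bool (pre m (conc s y) = w)) \<partial>lam0)"
      unfolding avg_def by (subst *) (rule refl)
    also have "\<dots> = (\<Sum>w\<in>Kw m. \<phi> w * avg (\<lambda>y. of_bool (pre m y = w)) s)"
      unfolding avg_def
    proof (subst Bochner_Integration.integral_sum)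
      fix w
      have "(\<lambda>y. of_bool (pre m (conc s y) = w)) \<in> borel_measurable lam0" by measurable
      then have "integrable lam0 (\<lambda>y. of_bool (pre m (conc s y) = w) :: real)"
        by (rule integrable_lam0_bounded[where C=1]) auto
      then show "integrable lam0 (\<lambda>y. \<phi> w * of_bool (pre m (conc s y) = w))" by simp
    qed simp
    finally show ?thesis .
  qed
  have "\<phi> (pre m y) - avg (\<lambda>y. \<phi> (pre m y)) s
    = (\<Sum>w\<in>Kw m. \<phi> w * (of_bool (pre m y = w) - avg (\<lambda>y. of_bool (pre m y = w)) s))" for y s
    by (simp only: *[of y] a right_diff_distrib sum_subtractf)
  then show ?thesis
    unfolding cyl_average_def
    by (simp only: sum_divide_distrib sum_distrib_left times_divide_eq_right) (rule sum.swap)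
qed

lemma AE_good: "AE x in lam0. good x"
proof -
  have "AE x in lam0. \<forall>m. \<forall>w. (\<lambda>N. cyl_average N x m (\<lambda>v. of_bool (v = w))) \<longlonglongrightarrow> 0"
    unfolding AE_all_countable by (intro allI AE_cyl_average)
  then show ?thesis
  proof eventually_elim
    case (elim x)
    show ?case unfolding good_def
    proof (intro allI)
      fix m \<phi>
      show "(\<lambda>N. cyl_average N x m \<phi>) \<longlonglongrightarrow> 0"
        unfolding cyl_average_linear[of _ x m \<phi>]
        by (intro tendsto_null_sum tendsto_mult_right_zero) (use elim in auto)
    qed
  qed
qed

end

section \<open>Terminal basic sets and stationary distributions\<close>

text \<open>The base point of the class links any two members. Used as irreducibility of \<Gamma> on
  the class and, later, to show that different classes are disjoint.\<close>

lemma terminal_basic_reach: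
  assumes "basic_set F B" "terminal F B" "t \<in> B"
  shows "F\<^sup>+ `` {t} = B"
proof
  show "F\<^sup>+ `` {t} \<subseteq> B" using assms(2,3) by (auto simp: terminal_def)
  obtain s where B: "B = {t. (s, t) \<in> F\<^sup>+ \<and> (t, s) \<in> F\<^sup>+}"
    using assms(1) by (auto simp: basic_set_def)
  show "B \<subseteq> F\<^sup>+ `` {t}"
  proof
    fix u assume "u \<in> B"
    then have "(t, s) \<in> F\<^sup>+" "(s, u) \<in> F\<^sup>+" using assms(3) by (simp_all add: B)
    then show "u \<in> F\<^sup>+ `` {t}" using trancl_trans by fast
  qed
qed

text \<open>Choose \<open>s\<close> in \<open>S\<close> with the fewest reachable points. By
  minimality every reachable point has the same forward reach, so this reach consists of mutually
  reachable points and cannot be left.\<close>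

lemma exists_terminal_basic:
  assumes "finite S" "S \<noteq> {}" "F `` S \<subseteq> S" and succ: "\<And>s. s \<in> S \<Longrightarrow> F `` {s} \<noteq> {}"
  shows "\<exists>B\<subseteq>S. B \<noteq> {} \<and> basic_set F B \<and> terminal F B"
proof -
  let ?R = "\<lambda>s. F\<^sup>+ `` {s}"
  have R_sub: "?R s \<subseteq> S" if "s \<in> S" for s
  proof
    fix t assume "t \<in> ?R s"
    then have "(s, t) \<in> F\<^sup>+" by simp
    then show "t \<in> S"
      by induction (use that assms(3) in blast)+
  qed
  obtain s where s: "s \<in> S" and min: "\<And>t. t \<in> S \<Longrightarrow> card (?R s) \<le> card (?R t)"
    using assms(2) ex_has_least_nat[of "\<lambda>s. s \<in> S" _ "\<lambda>s. card (?R s)"] by blast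
  have eq: "?R t = ?R s" if "t \<in> ?R s" for t
  proof (rule card_subset_eq)
    show "finite (?R s)" using R_sub[OF s] assms(1) by (rule finite_subset)
    show sub: "?R t \<subseteq> ?R s" using that by (simp add: subset_iff) (blast intro: trancl_trans)
    have "t \<in> S" using that R_sub[OF s] by auto
    then show "card (?R t) = card (?R s)"
      using min[of t] card_mono[OF \<open>finite (?R s)\<close> sub] by simp
  qed
  \<comment> \<open>\<open>s\<close> itself may fail to be recurrent, so the class is based at a
    successor \<open>t\<close>, which lies in \<open>?R s\<close> and hence in its own
    reach.\<close>
  obtain t where t: "t \<in> ?R s" using succ[OF s] by blast
  have "basic_set F (?R t)"
  proof -
    have tt: "(t, t) \<in> F\<^sup>+" using eq[OF t] t by auto
    have "(u, t) \<in> F\<^sup>+" if "(t, u) \<in> F\<^sup>+" for u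
    proof -
      have "u \<in> ?R s" using that eq[OF t] by auto
      then show ?thesis using eq[of u] t by auto
    qed
    then have "?R t = {u. (t, u) \<in> F\<^sup>+ \<and> (u, t) \<in> F\<^sup>+}" by auto
    then show ?thesis unfolding basic_set_def using tt by blast
  qed
  moreover have "terminal F (?R t)"
    unfolding terminal_def
  proof
    fix u assume "u \<in> F\<^sup>+ `` ?R t"
    then obtain w where "(t, w) \<in> F\<^sup>+" "(w, u) \<in> F\<^sup>+" by blast
    then show "u \<in> ?R t" using trancl_trans[of t w F u] by simp
  qed
  moreover have "?R t \<subseteq> S" "?R t \<noteq> {}"
    using t eq[OF t] R_sub[OF s] by auto
  ultimately show ?thesis by blast
qed

text \<open>Bolzano-Weierstrass is applied to one coordinate after another; passing to a further
  subsequence keeps the convergence already obtained.\<close>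

lemma finite_bounded_subseq:
  fixes f :: "nat \<Rightarrow> 'b \<Rightarrow> real"
  assumes "finite S" "\<And>N s. \<bar>f N s\<bar> \<le> C"
  shows "\<exists>r. strict_mono r \<and> (\<forall>s\<in>S. convergent (\<lambda>N. f (r N) s))"
  using assms(1)
proof induction
  case empty
  show ?case using strict_mono_id by blast
next
  case (insert a S)
  then obtain r where r: "strict_mono r" "\<forall>s\<in>S. convergent (\<lambda>N. f (r N) s)" by blast
  have "bounded (range (\<lambda>N. f (r N) a))"
    using assms(2) by (auto intro!: boundedI)
  then obtain l r' where r': "strict_mono r'" "((\<lambda>N. f (r N) a) \<circ> r') \<longlonglongrightarrow> l"
    using bounded_imp_convergent_subsequence by blast
  have "convergent (\<lambda>N. f ((r \<circ> r') N) s)" if "s \<in> S" for s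
    using convergent_subseq_convergent[of "\<lambda>N. f (r N) s" r'] r(2) r'(1) that by (simp add: o_def)
  moreover have "convergent (\<lambda>N. f ((r \<circ> r') N) a)"
    using r'(2) by (auto simp: convergent_def o_def)
  ultimately show ?case
    using strict_mono_o[OF r(1) r'(1)] unfolding o_def by (intro exI[of _ "\<lambda>N. r (r' N)"]) auto
qed

context shift_like
begin

abbreviation "G \<equiv> Grel n k \<gamma>"

abbreviation "Gam \<equiv> Gamma n k \<gamma>"

definition terminal_basic :: "'a list set \<Rightarrow> bool" where
  "terminal_basic B \<longleftrightarrow> basic_set G B \<and> terminal G B"

lemma Grel_iff: "(s, t) \<in> G \<longleftrightarrow> length s = n \<and> (\<exists>w. length w = k \<and> t = \<gamma> (s @ w))"
proof
  assume "(s, t) \<in> G"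
  then obtain s' where s': "length s' = n + k" "t = \<gamma> s'" "take n s' = s" "length s = n"
    by (auto simp: Grel_def Jn_def)
  then have "s @ drop n s' = s'" by (metis append_take_drop_id)
  then show "length s = n \<and> (\<exists>w. length w = k \<and> t = \<gamma> (s @ w))"
    using s' by (intro conjI exI[of _ "drop n s'"]) auto
next
  assume "length s = n \<and> (\<exists>w. length w = k \<and> t = \<gamma> (s @ w))"
  then obtain w where w: "length s = n" "length w = k" "t = \<gamma> (s @ w)" by blast
  then show "(s, t) \<in> G"
    by (auto simp: Grel_def Jn_def length_gamma intro!: bexI[of _ "s @ w"])
qed

lemma G_pre: "(pre n x, pre n (g x)) \<in> G"
proof -
  have "pre (n + k) x = pre n x @ drop n (pre (n + k) x)"
    using append_take_drop_id[of n "pre (n + k) x"] by simp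
  then show ?thesis
    unfolding Grel_iff pre_g by (intro conjI exI[of _ "drop n (pre (n + k) x)"]) auto
qed

lemma G_succ:
  assumes "length s = n"
  shows "G `` {s} \<noteq> {}"
proof -
  obtain w :: "'a list" where "length w = k" using Ex_list_of_length by blast
  then have "(s, \<gamma> (s @ w)) \<in> G" using assms by (auto simp: Grel_iff)
  then show ?thesis by blast
qed

lemma G_lengths: "(s, t) \<in> G\<^sup>+ \<Longrightarrow> length s = n \<and> length t = n"
  by (induction rule: trancl_induct) (auto simp: Grel_iff length_gamma)

lemma terminal_basic_subset: "terminal_basic B \<Longrightarrow> B \<subseteq> Kw n"
  unfolding terminal_basic_def basic_set_def using G_lengths by auto

lemma terminal_basic_nonempty: "terminal_basic B \<Longrightarrow> B \<noteq> {}"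
  unfolding terminal_basic_def basic_set_def by auto

lemma terminal_basic_pow:
  assumes "terminal_basic B" "pre n x \<in> B"
  shows "pre n ((g ^^ i) x) \<in> B"
proof (induction i)
  case (Suc i)
  then have "pre n (g ((g ^^ i) x)) \<in> G\<^sup>+ `` B"
    using G_pre by blast
  then show ?case using assms(1) by (auto simp: terminal_basic_def terminal_def)
qed (use assms in simp)

section \<open>The transition matrix and its stationary vectors\<close>

lemma Gamma_nonneg: "0 \<le> Gam t s"
  by (simp add: Gamma_def)

lemma Gamma_pos:
  assumes "(s, t) \<in> G"
  shows "0 < Gam t s"
proof -
  have "{w \<in> Kw (n+k). Jn n w = s \<and> \<gamma> w = t} \<noteq> {}"
    using assms by (auto simp: Grel_def)
  then have "0 < card {w \<in> Kw (n+k). Jn n w = s \<and> \<gamma> w = t}"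
    by (intro card_gt_0_iff[THEN iffD2] conjI finite_subset[OF _ finite_Kw[of "n+k"]]) auto
  then show ?thesis by (simp add: Gamma_def)
qed

text \<open>The total mass is left open so that the difference \<open>v - c * w\<close> in the
  uniqueness argument qualifies as well.\<close>

definition stationary :: "('a list \<Rightarrow> real) \<Rightarrow> bool" where
  "stationary v \<longleftrightarrow> (\<forall>s. 0 \<le> v s) \<and> (\<forall>t\<in>Kw n. (\<Sum>s\<in>Kw n. Gam t s * v s) = v t)"

text \<open>The mass sent from \<open>s\<close> to \<open>t\<close> is one positive summand of the
  stationarity equation at \<open>t\<close>, and the other summands are nonnegative.\<close>

lemma stationary_pos_step:
  assumes v: "stationary v" and "0 < v s" "(s, t) \<in> G"
  shows "0 < v t"
proof -
  have st: "s \<in> Kw n" "t \<in> Kw n" using G_lengths[of s t] assms by auto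
  have "0 < Gam t s * v s" using Gamma_pos assms by simp
  also have "\<dots> \<le> (\<Sum>s\<in>Kw n. Gam t s * v s)"
    using st v by (intro member_le_sum) (auto simp: stationary_def Gamma_nonneg)
  finally show ?thesis using v st by (simp add: stationary_def)
qed

lemma stationary_pos:
  assumes v: "stationary v" and "0 < v s" "(s, t) \<in> G\<^sup>+"
  shows "0 < v t"
  using assms(3,2) by induction (auto intro: stationary_pos_step[OF v])

text \<open>The predicate inside the definite description of \<open>vB\<close>, named so that
  existence and uniqueness can be treated separately.\<close>

definition vB_spec :: "'a list set \<Rightarrow> ('a list \<Rightarrow> real) \<Rightarrow> bool" where
  "vB_spec B v \<longleftrightarrow> (\<forall>s. 0 \<le> v s) \<and> {s. 0 < v s} = B \<and> (\<Sum>s\<in>Kw n. v s) = 1 \<and>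
       (\<forall>s2\<in>Kw n. (\<Sum>s1\<in>Kw n. Gam s2 s1 * v s1) = v s2)"

text \<open>Subtract from \<open>v\<close> the largest multiple \<open>c * w\<close> that stays
  below it. The difference \<open>d\<close> is stationary and vanishes at some point
  \<open>s0\<close> of \<open>B\<close>; were it positive anywhere, irreducibility would carry the
  positivity to \<open>s0\<close>. Hence \<open>v\<close> is a multiple of \<open>w\<close>, and
  normalisation gives \<open>c = 1\<close>.\<close>

lemma vB_spec_unique:
  assumes B: "terminal_basic B" and v: "vB_spec B v" and w: "vB_spec B w"
  shows "v = w"
proof -
  have fin: "finite B" using terminal_basic_subset[OF B] by (rule finite_subset) simp
  define c where "c = Min ((\<lambda>s. v s / w s) ` B)"
  have "c \<in> (\<lambda>s. v s / w s) ` B"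
    unfolding c_def using fin terminal_basic_nonempty[OF B] by (intro Min_in) auto
  then obtain s0 where s0: "s0 \<in> B" "c = v s0 / w s0" by blast
  define d where "d s = v s - c * w s" for s
  have zero: "v s = 0 \<and> w s = 0" if "s \<notin> B" for s
    using v w that by (auto simp: vB_spec_def order_less_le)
  have pos: "0 < v s \<and> 0 < w s" if "s \<in> B" for s
    using v w that by (auto simp: vB_spec_def)
  have d0: "0 \<le> d s" for s
  proof (cases "s \<in> B")
    case True
    then have "c \<le> v s / w s" unfolding c_def using fin by (intro Min_le) auto
    then show ?thesis using pos[OF True] by (simp add: d_def field_simps)
  qed (simp add: d_def zero)
  have "stationary d"
    using d0 v w unfolding stationary_def vB_spec_def d_def
    by (simp add: right_diff_distrib sum_subtractf mult.left_commute[of _ c] flip: sum_distrib_left)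
  then have "d s = 0" for s
  proof (rule_tac ccontr)
    assume "d s \<noteq> 0"
    then have "0 < d s" using d0[of s] by simp
    then have "s \<in> B" using zero[of s] by (cases "s \<in> B") (auto simp: d_def)
    then have "(s, s0) \<in> G\<^sup>+"
      using terminal_basic_reach[of G B s] B s0(1) by (auto simp: terminal_basic_def)
    then have "0 < d s0" using stationary_pos[OF \<open>stationary d\<close> \<open>0 < d s\<close>] by simp
    then show False using s0 pos[OF s0(1)] by (simp add: d_def)
  qed
  then have vc: "v s = c * w s" for s by (simp add: d_def)
  then have "(\<Sum>s\<in>Kw n. v s) = c * (\<Sum>s\<in>Kw n. w s)"
    by (simp add: sum_distrib_left)
  then have "c = 1" using v w by (simp add: vB_spec_def)
  then show ?thesis using vc by auto
qed

section \<open>Empirical frequencies of the leading words along an orbit\<close>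

definition freq :: "nat \<Rightarrow> (nat \<Rightarrow> 'a) \<Rightarrow> 'a list \<Rightarrow> real" where
  "freq N x t = (\<Sum>i<N. of_bool (pre n ((g ^^ i) x) = t)) / real N"

lemma freq_nonneg: "0 \<le> freq N x t"
  by (simp add: freq_def sum_nonneg)

lemma freq_le_1: "freq N x t \<le> 1"
proof -
  have "(\<Sum>i<N. of_bool (pre n ((g ^^ i) x) = t)) \<le> (\<Sum>i<N. 1 :: real)"
    by (intro sum_mono) auto
  then show ?thesis by (cases "N = 0") (simp_all add: freq_def divide_le_eq_1)
qed

lemma sum_freq:
  "(\<Sum>t\<in>Kw n. \<phi> t * freq N x t) = (\<Sum>i<N. \<phi> (pre n ((g ^^ i) x))) / real N"
proof -
  have "(\<Sum>t\<in>Kw n. \<phi> t * of_bool (pre n y = t)) = \<phi> (pre n y)" for y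
  proof -
    have "(\<Sum>t\<in>Kw n. \<phi> t * of_bool (pre n y = t)) = (\<Sum>t\<in>Kw n. if t = pre n y then \<phi> t else 0)"
      by (intro sum.cong) auto
    then show ?thesis by simp
  qed
  then have "(\<Sum>i<N. \<phi> (pre n ((g ^^ i) x))) = (\<Sum>i<N. \<Sum>t\<in>Kw n. \<phi> t * of_bool (pre n ((g ^^ i) x) = t))"
    by simp
  also have "\<dots> = (\<Sum>t\<in>Kw n. \<Sum>i<N. \<phi> t * of_bool (pre n ((g ^^ i) x) = t))"
    by (rule sum.swap)
  finally show ?thesis
    by (simp only: freq_def sum_divide_distrib sum_distrib_left times_divide_eq_right)
qed

text \<open>Apply \<open>good\<close> to the indicator of \<open>\<gamma> w = t\<close> on words of
  length \<open>n + k\<close>, that is, to the event that the next leading word is \<open>t\<close>.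
  Its conditional mean is a matrix entry, and its own average is the frequency of \<open>t\<close>
  with the time index moved by one.\<close>

lemma freq_almost_stationary:
  assumes "good x" "t \<in> Kw n"
  shows "(\<lambda>N. (\<Sum>s\<in>Kw n. Gam t s * freq N x s) - freq N x t) \<longlonglongrightarrow> 0"
proof -
  let ?Y = "\<lambda>i. pre n ((g ^^ i) x)"
  let ?\<phi> = "\<lambda>w. of_bool (\<gamma> w = t) :: real"
  let ?u = "\<lambda>y. of_bool (pre n y = t) :: real"
  have phi: "?\<phi> (pre (n + k) y) = ?u (g y)" for y by (simp add: pre_g)
  have avg: "avg (\<lambda>y. ?u (g y)) s = Gam t s" if s: "length s = n" for s
  proof -
    have "avg (\<lambda>y. ?u (g y)) s = (\<Sum>t'\<in>Kw n. Gam t' s * avg ?u t')"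
      by (rule avg_g[where C=1]) (use s in auto)
    also have "\<dots> = (\<Sum>t'\<in>Kw n. if t' = t then Gam t' s else 0)"
    proof (intro sum.cong refl)
      interpret prob_space "lam0 :: (nat \<Rightarrow> 'a) measure" by (rule prob_space_lam0)
      fix t' :: "'a list" assume "t' \<in> Kw n"
      then have "pre n (conc t' y) = t'" for y using pre_conc_same[of t' y] by simp
      then show "Gam t' s * avg ?u t' = (if t' = t then Gam t' s else 0)"
        using prob_space by (simp add: avg_def)
    qed
    also have "\<dots> = Gam t s" using assms(2) by simp
    finally show ?thesis .
  qed
  \<comment> \<open>Moving the index by one exchanges the visit at time 0 for the one at time
    \<open>N\<close>; this is the boundary term, of order \<open>1 / N\<close>.\<close>
  have "cyl_average N x (n + k) ?\<phi> + (of_bool (?Y 0 = t) - of_bool (?Y N = t)) / real N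
     = freq N x t - (\<Sum>s\<in>Kw n. Gam t s * freq N x s)" for N
  proof -
    define p where "p = (\<Sum>i<N. of_bool (?Y i = t) :: real)"
    define q where "q = (\<Sum>i<N. Gam t (?Y i))"
    have "(\<Sum>i<N. ?\<phi> (pre (n + k) ((g ^^ i) x)) - avg (\<lambda>y. ?\<phi> (pre (n + k) y)) (?Y i))
       = (\<Sum>i<N. of_bool (?Y (Suc i) = t)) - q"
      by (simp add: avg phi sum_subtractf q_def)
    also have "(\<Sum>i<N. of_bool (?Y (Suc i) = t)) = p + of_bool (?Y N = t) - (of_bool (?Y 0 = t) :: real)"
      using sum.lessThan_Suc_shift[of "\<lambda>i. of_bool (?Y i = t) :: real" N] by (simp add: p_def)
    finally have "cyl_average N x (n + k) ?\<phi> = (p + of_bool (?Y N = t) - of_bool (?Y 0 = t) - q) / real N"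
      unfolding cyl_average_def by simp
    then show ?thesis
      unfolding sum_freq unfolding freq_def p_def[symmetric] q_def[symmetric]
      by (simp add: add_divide_distrib diff_divide_distrib)
  qed
  moreover have "(\<lambda>N. cyl_average N x (n + k) ?\<phi> + (of_bool (?Y 0 = t) - of_bool (?Y N = t)) / real N) \<longlonglongrightarrow> 0 + 0"
  proof (intro tendsto_add)
    show "(\<lambda>N. cyl_average N x (n + k) ?\<phi>) \<longlonglongrightarrow> 0"
      using assms(1) by (simp add: good_def)
    show "(\<lambda>N. (of_bool (?Y 0 = t) - of_bool (?Y N = t)) / real N) \<longlonglongrightarrow> 0"
      by (rule Lim_null_comparison[OF _ lim_const_over_n[of 1]]) (auto intro!: always_eventually divide_right_mono)
  qed
  ultimately have "(\<lambda>N. freq N x t - (\<Sum>s\<in>Kw n. Gam t s * freq N x s)) \<longlonglongrightarrow> 0" by simp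
  from tendsto_minus[OF this] show ?thesis by simp
qed

text \<open>By compactness the frequencies converge along a further subsequence, and approximate
  stationarity becomes exact in the limit. An arbitrary initial subsequence \<open>r\<close> is
  allowed so that convergence of the full sequence can be deduced later.\<close>

lemma freq_limit_point:
  fixes r :: "nat \<Rightarrow> nat"
  assumes x: "good x" and r: "strict_mono r"
  shows "\<exists>r' v. strict_mono r' \<and> (\<forall>t. (\<lambda>N. freq (r (r' N)) x t) \<longlonglongrightarrow> v t) \<and>
    stationary v \<and> (\<Sum>s\<in>Kw n. v s) = 1"
proof -
  obtain r' where r': "strict_mono r'" "\<forall>t\<in>Kw n. convergent (\<lambda>N. freq (r (r' N)) x t)"
    using finite_bounded_subseq[of "Kw n" "\<lambda>N t. freq (r N) x t" 1] freq_nonneg freq_le_1 by auto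
  have out: "freq N x t = 0" if "t \<notin> Kw n" for t N
    using that by (auto simp: freq_def intro!: sum.neutral)
  define v where "v t = lim (\<lambda>N. freq (r (r' N)) x t)" for t
  have lim: "(\<lambda>N. freq (r (r' N)) x t) \<longlonglongrightarrow> v t" for t
  proof -
    have "convergent (\<lambda>N. freq (r (r' N)) x t)"
      using r'(2) out by (cases "t \<in> Kw n") (auto simp: convergent_const)
    then show ?thesis unfolding v_def by (simp add: convergent_LIMSEQ_iff)
  qed
  have sm: "strict_mono (\<lambda>N. r (r' N))"
    using strict_mono_o[OF r r'(1)] by (simp add: o_def)
  have "0 \<le> v t" for t
    using lim by (rule LIMSEQ_le_const) (auto intro: freq_nonneg)
  moreover have "(\<Sum>s\<in>Kw n. Gam t s * v s) = v t" if t: "t \<in> Kw n" for t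
  proof -
    have "(\<lambda>N. (\<Sum>s\<in>Kw n. Gam t s * freq (r (r' N)) x s) - freq (r (r' N)) x t)
        \<longlonglongrightarrow> (\<Sum>s\<in>Kw n. Gam t s * v s) - v t"
      by (intro tendsto_intros lim)
    moreover have "(\<lambda>N. (\<Sum>s\<in>Kw n. Gam t s * freq (r (r' N)) x s) - freq (r (r' N)) x t) \<longlonglongrightarrow> 0"
      using LIMSEQ_subseq_LIMSEQ[OF freq_almost_stationary[OF x t] sm] by (simp add: o_def)
    ultimately have "(\<Sum>s\<in>Kw n. Gam t s * v s) - v t = 0" by (rule LIMSEQ_unique)
    then show ?thesis by simp
  qed
  moreover have "(\<Sum>s\<in>Kw n. v s) = 1"
  proof -
    \<comment> \<open>At \<open>N = 0\<close> all frequencies are zero by the convention for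
      division, so the total mass is 1 only for positive lengths.\<close>
    have "(\<Sum>s\<in>Kw n. freq N x s) = 1" if "0 < N" for N
      using sum_freq[of "\<lambda>_. 1" N x] that by simp
    moreover have "0 < r (r' N)" if "0 < N" for N
      using strict_mono_imp_increasing[OF sm, of N] that by simp
    ultimately have "eventually (\<lambda>N. (\<Sum>s\<in>Kw n. freq (r (r' N)) x s) = 1) sequentially"
      by (intro eventually_sequentiallyI[of 1]) auto
    then have "(\<lambda>N. \<Sum>s\<in>Kw n. freq (r (r' N)) x s) \<longlonglongrightarrow> 1"
      by (rule tendsto_eventually)
    moreover have "(\<lambda>N. \<Sum>s\<in>Kw n. freq (r (r' N)) x s) \<longlonglongrightarrow> (\<Sum>s\<in>Kw n. v s)"
      by (intro tendsto_sum lim)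
    ultimately show ?thesis using LIMSEQ_unique by metis
  qed
  ultimately show ?thesis using r'(1) lim unfolding stationary_def by blast
qed

text \<open>Words outside \<open>B\<close> can occur only before time \<open>i0\<close>, so their
  frequencies tend to zero and the limit lives on \<open>B\<close>. Mass somewhere in
  \<open>B\<close> spreads over all of \<open>B\<close> by irreducibility.\<close>

lemma freq_limit_point_in:
  fixes r :: "nat \<Rightarrow> nat"
  assumes x: "good x" and r: "strict_mono r" and B: "terminal_basic B" and ent: "pre n ((g ^^ i0) x) \<in> B"
  shows "\<exists>r' v. strict_mono r' \<and> (\<forall>t. (\<lambda>N. freq (r (r' N)) x t) \<longlonglongrightarrow> v t) \<and> vB_spec B v"
proof -
  obtain r' v where r': "strict_mono r'" and lim: "\<And>t. (\<lambda>N. freq (r (r' N)) x t) \<longlonglongrightarrow> v t"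
    and st: "stationary v" and one: "(\<Sum>s\<in>Kw n. v s) = 1"
    using freq_limit_point[OF x r] by blast
  have sm: "strict_mono (\<lambda>N. r (r' N))"
    using strict_mono_o[OF r r'] by (simp add: o_def)
  have zero: "v t = 0" if "t \<notin> B" for t
  proof -
    have stay: "pre n ((g ^^ i) x) \<in> B" if "i0 \<le> i" for i
      using terminal_basic_pow[OF B ent, of "i - i0"] that
      by (metis comp_apply funpow_add le_add_diff_inverse2)
    have "norm (freq N x t) \<le> real i0 / real N" for N
    proof -
      have "(\<Sum>i<N. of_bool (pre n ((g ^^ i) x) = t)) \<le> (\<Sum>i<N. if i \<in> {..<i0} then 1 else 0 :: real)"
        using stay \<open>t \<notin> B\<close> by (intro sum_mono) (auto simp: not_less)
      also have "\<dots> = real (card ({..<N} \<inter> {..<i0}))"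
        by (subst sum.inter_restrict[symmetric]) auto
      also have "\<dots> \<le> real i0"
        using card_mono[of "{..<i0}" "{..<N} \<inter> {..<i0}"] by simp
      finally show ?thesis
        using freq_nonneg[of N x t] by (auto simp: freq_def intro!: divide_right_mono)
    qed
    then have "(\<lambda>N. freq N x t) \<longlonglongrightarrow> 0"
      by (intro Lim_null_comparison[OF _ lim_const_over_n[of "real i0"]] always_eventually) auto
    from LIMSEQ_subseq_LIMSEQ[OF this sm] lim[of t] show ?thesis
      by (simp add: o_def LIMSEQ_unique)
  qed
  have "\<exists>s\<in>Kw n. v s \<noteq> 0"
    using one sum.neutral[of "Kw n" v] by (metis zero_neq_one)
  then obtain s where s: "s \<in> Kw n" "0 < v s"
    using st by (auto simp: stationary_def order_less_le)
  have "0 < v t" if "t \<in> B" for t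
  proof (rule stationary_pos[OF st s(2)])
    have "s \<in> B" using zero[of s] s by auto
    then show "(s, t) \<in> G\<^sup>+"
      using terminal_basic_reach[of G B s] B that by (auto simp: terminal_basic_def)
  qed
  then have "{s. 0 < v s} = B" using zero by force
  then have "vB_spec B v" using st one by (simp add: vB_spec_def stationary_def)
  then show ?thesis using r' lim by blast
qed

text \<open>A cylinder has positive measure and so cannot avoid a set of full measure. This supplies
  starting points inside any given class.\<close>

lemma exists_good:
  assumes "length s = n"
  shows "\<exists>x. good x \<and> pre n x = s"
proof (rule ccontr)
  assume "\<nexists>x. good x \<and> pre n x = s"
  then have "AE x in lam0. x \<notin> {x. pre n x = s}"
    using AE_good by (auto elim: eventually_mono)
  then have "emeasure lam0 {x. pre n x = s} = 0"
    using sets_cylinder[of n s] by (subst (asm) AE_iff_measurable[where N="{x. pre n x = s}"]) auto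
  then show False using measure_pre_eq[OF assms] by (simp add: measure_def)
qed

text \<open>Existence is obtained dynamically: the frequencies of a good orbit that starts in
  \<open>B\<close> have a limit point satisfying \<open>vB_spec\<close>. Uniqueness then evaluates
  the definite description.\<close>

lemma vB_spec_vB:
  assumes B: "terminal_basic B"
  shows "vB_spec B (vB n k \<gamma> B)"
proof -
  obtain s where s: "s \<in> B" using terminal_basic_nonempty[OF B] by auto
  then have "length s = n" using terminal_basic_subset[OF B] by auto
  from exists_good[OF this] s obtain x where x: "good x" "pre n x \<in> B" by auto
  obtain v where "vB_spec B v"
    using freq_limit_point_in[OF x(1) strict_mono_id B, of 0] x(2) by auto
  then have "vB_spec B (THE v. vB_spec B v)"
    by (intro theI[of "vB_spec B" v] vB_spec_unique[OF B])
  then show ?thesis unfolding vB_def vB_spec_def by simp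
qed

text \<open>Otherwise some subsequence stays at distance at least \<open>e\<close> from the claimed
  limit; yet a further subsequence converges to a vector satisfying \<open>vB_spec\<close>, which by
  uniqueness is \<open>vB n k \<gamma> B\<close>.\<close>

lemma freq_tendsto:
  assumes x: "good x" and B: "terminal_basic B" and ent: "pre n ((g ^^ i0) x) \<in> B"
  shows "(\<lambda>N. freq N x t) \<longlonglongrightarrow> vB n k \<gamma> B t"
proof (rule ccontr)
  let ?l = "vB n k \<gamma> B t"
  assume "\<not> (\<lambda>N. freq N x t) \<longlonglongrightarrow> ?l"
  then obtain e where e: "e > 0" "\<And>N. \<exists>M\<ge>N. e \<le> dist (freq M x t) ?l"
    by (auto simp: lim_sequentially not_less)
  have "infinite {M. e \<le> dist (freq M x t) ?l}"
    unfolding infinite_nat_iff_unbounded_le using e(2) by auto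
  from infinite_enumerate[OF this] obtain r :: "nat \<Rightarrow> nat"
    where r: "strict_mono r" "\<And>N. e \<le> dist (freq (r N) x t) ?l" by auto
  obtain r' v where r': "(\<lambda>N. freq (r (r' N)) x t) \<longlonglongrightarrow> v t" "vB_spec B v"
    using freq_limit_point_in[OF x r(1) B ent] by blast
  have "v = vB n k \<gamma> B" using vB_spec_unique[OF B r'(2) vB_spec_vB[OF B]] .
  with r'(1) e(1) obtain N where "dist (freq (r (r' N)) x t) ?l < e"
    unfolding lim_sequentially by blast
  with r(2)[of "r' N"] show False by simp
qed

text \<open>The support of a limit vector is closed under \<open>G\<close>, so it contains a
  terminal class. A word of positive limit frequency must occur along the orbit, which therefore
  visits that class.\<close>

lemma good_enters_terminal:
  assumes x: "good x"
  shows "\<exists>B i. terminal_basic B \<and> pre n ((g ^^ i) x) \<in> B"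
proof -
  obtain r v where lim: "\<And>t. (\<lambda>N. freq (r N) x t) \<longlonglongrightarrow> v t"
    and st: "stationary v" and one: "(\<Sum>s\<in>Kw n. v s) = 1"
    using freq_limit_point[OF x strict_mono_id] by auto
  let ?S = "{s\<in>Kw n. 0 < v s}"
  have "\<exists>s\<in>Kw n. v s \<noteq> 0"
    using one sum.neutral[of "Kw n" v] by (metis zero_neq_one)
  then have "?S \<noteq> {}" using st by (auto simp: stationary_def order_less_le)
  moreover have "G `` ?S \<subseteq> ?S"
  proof
    fix t assume "t \<in> G `` ?S"
    then obtain s where "(s, t) \<in> G" "0 < v s" by blast
    with stationary_pos_step[OF st] G_lengths[of s t] show "t \<in> ?S" by auto
  qed
  moreover have "G `` {s} \<noteq> {}" if "s \<in> ?S" for s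
    using that by (intro G_succ) simp
  ultimately have "\<exists>B\<subseteq>?S. B \<noteq> {} \<and> basic_set G B \<and> terminal G B"
    by (intro exists_terminal_basic finite_subset[OF _ finite_Kw[of n]]) auto
  then obtain B where B: "B \<subseteq> ?S" "B \<noteq> {}" "terminal_basic B"
    unfolding terminal_basic_def by blast
  then obtain t where t: "t \<in> B" "0 < v t" by auto
  have "\<exists>N. freq (r N) x t \<noteq> 0"
  proof (rule ccontr)
    assume "\<nexists>N. freq (r N) x t \<noteq> 0"
    then have "(\<lambda>N. freq (r N) x t) \<longlonglongrightarrow> 0" by simp
    from LIMSEQ_unique[OF this lim[of t]] t(2) show False by simp
  qed
  then obtain N where "freq (r N) x t \<noteq> 0" ..
  then obtain i where "pre n ((g ^^ i) x) = t"
    by (fastforce simp: freq_def)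
  then show ?thesis using B(3) t(1) by blast
qed

text \<open>The average splits into the centred part, which vanishes in the limit, and the
  conditional means weighted with the frequencies of the leading words, which converge.\<close>

lemma good_cylinder_average:
  assumes x: "good x" and B: "terminal_basic B" and ent: "pre n ((g ^^ i0) x) \<in> B"
  shows "(\<lambda>N. (\<Sum>i<N. \<phi> (pre m ((g ^^ i) x))) / real N)
    \<longlonglongrightarrow> (\<Sum>s\<in>Kw n. vB n k \<gamma> B s * avg (\<lambda>y. \<phi> (pre m y)) s)"
proof -
  let ?a = "avg (\<lambda>y. \<phi> (pre m y))"
  have "(\<lambda>N. cyl_average N x m \<phi> + (\<Sum>s\<in>Kw n. ?a s * freq N x s))
    \<longlonglongrightarrow> 0 + (\<Sum>s\<in>Kw n. ?a s * vB n k \<gamma> B s)"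
    using x unfolding good_def by (intro tendsto_intros freq_tendsto[OF x B ent]) auto
  moreover have "cyl_average N x m \<phi> + (\<Sum>s\<in>Kw n. ?a s * freq N x s) = (\<Sum>i<N. \<phi> (pre m ((g ^^ i) x))) / real N" for N
    unfolding sum_freq cyl_average_def by (simp add: sum_subtractf diff_divide_distrib)
  ultimately show ?thesis by (simp add: mult.commute)
qed

end

section \<open>The measures attached to terminal basic sets\<close>

context shift_like
begin

abbreviation "vv B \<equiv> vB n k \<gamma> B"

abbreviation "LB B \<equiv> lamB n k \<gamma> B"

definition dens :: "'a list set \<Rightarrow> (nat \<Rightarrow> 'a) \<Rightarrow> real" where
  "dens B x = real CARD('a) ^ n * vv B (pre n x)"

lemma measurable_dens [measurable]: "dens B \<in> borel_measurable lam0"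
  unfolding dens_def by measurable

lemma vv_nonneg: "terminal_basic B \<Longrightarrow> 0 \<le> vv B s"
  and vv_pos_iff: "terminal_basic B \<Longrightarrow> 0 < vv B s \<longleftrightarrow> s \<in> B"
  and vv_sum: "terminal_basic B \<Longrightarrow> (\<Sum>s\<in>Kw n. vv B s) = 1"
  and vv_stationary: "terminal_basic B \<Longrightarrow> length t = n \<Longrightarrow> (\<Sum>s\<in>Kw n. Gam t s * vv B s) = vv B t"
  using vB_spec_vB[of B] by (auto simp: vB_spec_def)

lemma vv_zero: "terminal_basic B \<Longrightarrow> s \<notin> B \<Longrightarrow> vv B s = 0"
  using vv_pos_iff[of B s] vv_nonneg[of B s] by auto

lemma dens_nonneg: "terminal_basic B \<Longrightarrow> 0 \<le> dens B x"
  by (simp add: dens_def vv_nonneg)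

lemma integral_dens:
  assumes u [measurable]: "u \<in> borel_measurable lam0" and C: "\<And>x. \<bar>u x :: real\<bar> \<le> C"
  shows "(\<integral>x. dens B x * u x \<partial>lam0) = (\<Sum>s\<in>Kw n. vv B s * avg u s)"
proof -
  obtain D where D: "\<And>x. \<bar>real CARD('a) ^ n * vv B (pre n x)\<bar> \<le> D"
    using bounded_on_pre[of "\<lambda>s. real CARD('a) ^ n * vv B s" n] by auto
  \<comment> \<open>At time 0 the conditioning identity lets \<open>u\<close> be replaced by its
    mean given the first \<open>n\<close> letters, since \<open>dens B\<close> depends only on
    these.\<close>
  have "(\<integral>x. dens B x * u ((g ^^ 0) x) \<partial>lam0) = (\<integral>x. dens B x * avg u (pre n ((g ^^ 0) x)) \<partial>lam0)"
  proof (rule integral_conditional[OF _ _ _ u C])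
    show "\<bar>dens B x\<bar> \<le> D" for x using D by (simp add: dens_def)
    show "dens B (conc (pre (n + 0 * k) x) y) = dens B x" for x y
      by (simp add: dens_def pre_conc_le)
  qed measurable
  then have "(\<integral>x. dens B x * u x \<partial>lam0) = (\<integral>x. real CARD('a) ^ n * vv B (pre n x) * avg u (pre n x) \<partial>lam0)"
    by (simp add: dens_def)
  also have "\<dots> = (\<Sum>s\<in>Kw n. real CARD('a) ^ n * vv B s * avg u s) / real CARD('a) ^ n"
    by (rule integral_pre)
  also have "\<dots> = (\<Sum>s\<in>Kw n. vv B s * avg u s)"
    by (simp add: sum_divide_distrib)
  finally show ?thesis .
qed

lemma emeasure_density_dens:
  assumes B: "terminal_basic B" and A [measurable]: "A \<in> sets lam0"
  shows "emeasure (density lam0 (dens B)) A = ennreal (\<Sum>s\<in>Kw n. vv B s * avg (indicator A) s)"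
proof -
  have ind: "(indicator A :: _ \<Rightarrow> real) \<in> borel_measurable lam0" by measurable
  obtain D where D: "\<And>x. \<bar>real CARD('a) ^ n * vv B (pre n x)\<bar> \<le> D"
    using bounded_on_pre[of "\<lambda>s. real CARD('a) ^ n * vv B s" n] by auto
  have "emeasure (density lam0 (dens B)) A = (\<integral>\<^sup>+x. ennreal (dens B x) * indicator A x \<partial>lam0)"
    by (intro emeasure_density) measurable
  also have "\<dots> = (\<integral>\<^sup>+x. ennreal (dens B x * indicator A x) \<partial>lam0)"
    by (intro nn_integral_cong) (auto simp: indicator_def)
  also have "\<dots> = ennreal (\<integral>x. dens B x * indicator A x \<partial>lam0)"
  proof (rule nn_integral_eq_integral)
    show "integrable lam0 (\<lambda>x. dens B x * indicator A x)"
    proof (rule integrable_lam0_bounded[where C=D])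
      show "\<bar>dens B x * indicator A x\<bar> \<le> D" for x
        using D[of x] by (auto simp: dens_def indicator_def)
    qed measurable
  qed (use dens_nonneg[OF B] in auto)
  also have "(\<integral>x. dens B x * indicator A x \<partial>lam0) = (\<Sum>s\<in>Kw n. vv B s * avg (indicator A) s)"
    by (rule integral_dens[OF ind, where C=1]) (auto simp: indicator_def)
  finally show ?thesis .
qed

lemma emeasure_lam_s:
  fixes s :: "'a list"
  assumes A [measurable]: "A \<in> sets lam0"
  shows "emeasure (lam_s s) A = ennreal (avg (indicator A) s)"
proof -
  interpret prob_space "lam0 :: (nat \<Rightarrow> 'a) measure" by (rule prob_space_lam0)
  have meas: "conc s -` A \<in> sets lam0"
    using measurable_sets[OF measurable_conc A, of s] by simp
  have "emeasure (lam_s s) A = emeasure lam0 (conc s -` A)"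
    by (simp add: lam_s_eq_distr emeasure_distr)
  also have "\<dots> = ennreal (\<integral>y. indicator (conc s -` A) y \<partial>lam0)"
    using meas by (simp add: emeasure_eq_measure)
  also have "(\<integral>y. indicator (conc s -` A) y \<partial>lam0) = (avg (indicator A) s :: real)"
    by (simp add: avg_def indicator_def)
  finally show ?thesis .
qed

lemma avg_indicator_nonneg: "0 \<le> avg (indicator A) s"
  unfolding avg_def by (rule integral_nonneg_AE) simp

text \<open>The weighted sum is the evaluation of an actual measure, so \<open>measure_of\<close>
  returns that measure; absolute continuity then transfers almost sure statements from
  \<open>lam0\<close>.\<close>

lemma lamB_eq_density:
  assumes B: "terminal_basic B"
  shows "LB B = density lam0 (dens B)"
proof -
  have fin: "finite B" using terminal_basic_subset[OF B] by (rule finite_subset) simp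
  have eq: "(\<Sum>s\<in>B. ennreal (vv B s) * emeasure (lam_s s) A) = emeasure (density lam0 (dens B)) A"
    if A: "A \<in> sets lam0" for A
  proof -
    have "(\<Sum>s\<in>B. ennreal (vv B s) * emeasure (lam_s s) A) = (\<Sum>s\<in>B. ennreal (vv B s * avg (indicator A) s))"
      by (simp add: emeasure_lam_s[OF A] ennreal_mult vv_nonneg[OF B] avg_indicator_nonneg)
    also have "\<dots> = ennreal (\<Sum>s\<in>B. vv B s * avg (indicator A) s)"
      by (intro sum_ennreal) (simp add: vv_nonneg[OF B] avg_indicator_nonneg)
    also have "(\<Sum>s\<in>B. vv B s * avg (indicator A) s) = (\<Sum>s\<in>Kw n. vv B s * avg (indicator A) s)"
      using terminal_basic_subset[OF B] vv_zero[OF B] by (intro sum.mono_neutral_left) auto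
    finally show ?thesis by (simp add: emeasure_density_dens[OF B A])
  qed
  have "LB B = measure_of (space (lam0 :: (nat \<Rightarrow> 'a) measure)) (sets lam0) (emeasure (density lam0 (dens B)))"
    unfolding lamB_def
    by (rule measure_of_eq[OF sets.space_closed]) (simp only: sets.sigma_sets_eq eq)
  also have "\<dots> = density lam0 (dens B)"
    using measure_of_of_measure[of "density lam0 (dens B)"] by simp
  finally show ?thesis .
qed

lemma sets_lamB: "terminal_basic B \<Longrightarrow> sets (LB B) = sets lam0"
  and space_lamB: "terminal_basic B \<Longrightarrow> space (LB B) = UNIV"
  by (simp_all add: lamB_eq_density)

lemma measurable_lamB_cong:
  assumes "terminal_basic B"
  shows "measurable (LB B) M = measurable lam0 M" "measurable M (LB B) = measurable M lam0"
  using assms by (auto intro!: measurable_cong_sets simp: sets_lamB)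

lemma integral_lamB:
  assumes "terminal_basic B" "u \<in> borel_measurable lam0" "\<And>x. \<bar>u x :: real\<bar> \<le> C"
  shows "(\<integral>x. u x \<partial>LB B) = (\<Sum>s\<in>Kw n. vv B s * avg u s)"
  using assms dens_nonneg[OF assms(1)]
  by (simp add: lamB_eq_density integral_real_density integral_dens[of u C])

lemma emeasure_lamB:
  assumes "terminal_basic B" "A \<in> sets lam0"
  shows "emeasure (LB B) A = ennreal (\<Sum>s\<in>Kw n. vv B s * avg (indicator A) s)"
  using emeasure_density_dens[OF assms] by (simp add: lamB_eq_density assms)

lemma prob_space_lamB:
  assumes B: "terminal_basic B"
  shows "prob_space (LB B)"
proof (rule prob_spaceI)
  interpret prob_space "lam0 :: (nat \<Rightarrow> 'a) measure" by (rule prob_space_lam0)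
  have "UNIV \<in> sets (lam0 :: (nat \<Rightarrow> 'a) measure)"
    using sets.top[of "lam0 :: (nat \<Rightarrow> 'a) measure"] by simp
  moreover have "avg (indicator UNIV) s = 1" for s :: "'a list"
    using prob_space by (simp add: avg_def)
  ultimately show "emeasure (LB B) (space (LB B)) = 1"
    using emeasure_lamB[OF B, of UNIV] vv_sum[OF B] by (simp add: space_lamB[OF B])
qed

text \<open>\<open>avg_g\<close> expands the measure of a preimage as a double sum over words; after
  the sums are interchanged, the claim is the stationarity of \<open>vv B\<close>.\<close>

lemma invariant_lamB:
  assumes B: "terminal_basic B"
  shows "invariant_measure g (LB B)"
  unfolding invariant_measure_def
proof
  show mg: "g \<in> LB B \<rightarrow>\<^sub>M LB B" by (simp add: measurable_lamB_cong[OF B] measurable_g)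
  show "distr (LB B) (LB B) g = LB B"
  proof (rule measure_eqI)
    fix A assume "A \<in> sets (distr (LB B) (LB B) g)"
    then have A [measurable]: "A \<in> sets lam0" by (simp add: sets_lamB[OF B])
    have gA: "g -` A \<in> sets lam0"
      using measurable_sets[OF measurable_g A] by simp
    have ind: "(indicator A :: _ \<Rightarrow> real) \<in> borel_measurable lam0" by measurable
    have avg: "avg (indicator (g -` A)) s = (\<Sum>t\<in>Kw n. Gam t s * avg (indicator A) t)" if "length s = n" for s
    proof -
      have "avg (\<lambda>x. indicator A (g x)) s = (\<Sum>t\<in>Kw n. Gam t s * avg (indicator A) t)"
        by (rule avg_g[OF ind, where C=1]) (auto simp: indicator_def that)
      moreover have "(\<lambda>x. indicator A (g x)) = (indicator (g -` A) :: _ \<Rightarrow> real)"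
        by (auto simp: indicator_def)
      ultimately show ?thesis by simp
    qed
    have "emeasure (distr (LB B) (LB B) g) A = emeasure (LB B) (g -` A)"
      using A mg by (simp add: emeasure_distr sets_lamB[OF B] space_lamB[OF B])
    also have "\<dots> = ennreal (\<Sum>s\<in>Kw n. vv B s * avg (indicator (g -` A)) s)"
      by (rule emeasure_lamB[OF B gA])
    also have "(\<Sum>s\<in>Kw n. vv B s * avg (indicator (g -` A)) s)
       = (\<Sum>s\<in>Kw n. \<Sum>t\<in>Kw n. (Gam t s * vv B s) * avg (indicator A) t)"
      by (intro sum.cong refl) (simp add: avg sum_distrib_left mult_ac)
    also have "\<dots> = (\<Sum>t\<in>Kw n. \<Sum>s\<in>Kw n. (Gam t s * vv B s) * avg (indicator A) t)"
      by (rule sum.swap)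
    also have "\<dots> = (\<Sum>t\<in>Kw n. vv B t * avg (indicator A) t)"
      by (simp only: flip: sum_distrib_right) (simp add: vv_stationary[OF B])
    also have "ennreal \<dots> = emeasure (LB B) A"
      by (simp add: emeasure_lamB[OF B A])
    finally show "emeasure (distr (LB B) (LB B) g) A = emeasure (LB B) A" .
  qed simp
qed

lemma integral_lamB_g_pow:
  assumes B: "terminal_basic B" and u: "u \<in> borel_measurable lam0"
  shows "(\<integral>x. u ((g ^^ i) x) \<partial>LB B) = (\<integral>x. u x \<partial>LB B :: real)"
proof (induction i)
  case (Suc i)
  have mg: "g \<in> LB B \<rightarrow>\<^sub>M LB B" and inv: "distr (LB B) (LB B) g = LB B"
    using invariant_lamB[OF B] by (auto simp: invariant_measure_def)
  have "(\<lambda>x. u ((g ^^ i) x)) \<in> borel_measurable (LB B)"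
    unfolding measurable_lamB_cong[OF B] using u by measurable
  from integral_distr[OF mg this]
  have "(\<integral>x. u ((g ^^ i) (g x)) \<partial>LB B) = (\<integral>x. u ((g ^^ i) x) \<partial>LB B)" by (simp add: inv)
  then show ?case using Suc by (simp add: funpow_Suc_right del: funpow.simps)
qed simp

lemma cylinder_average_lamB:
  assumes x: "good x" and B: "terminal_basic B" and ent: "pre n ((g ^^ i0) x) \<in> B"
  shows "(\<lambda>N. (\<Sum>i<N. \<phi> (pre m ((g ^^ i) x))) / real N) \<longlonglongrightarrow> (\<integral>y. \<phi> (pre m y) \<partial>LB B)"
proof -
  obtain C where C: "\<And>x. \<bar>\<phi> (pre m x)\<bar> \<le> C" using bounded_on_pre[of \<phi> m] by auto
  have "(\<lambda>y. \<phi> (pre m y)) \<in> borel_measurable lam0" by measurable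
  from integral_lamB[OF B this C] show ?thesis
    using good_cylinder_average[OF x B ent, of \<phi> m] by simp
qed

lemma AE_lamB:
  assumes B: "terminal_basic B"
  shows "AE x in LB B. good x \<and> pre n x \<in> B"
proof -
  have "AE x in density lam0 (dens B). good x \<and> pre n x \<in> B"
  proof (subst AE_density)
    show "AE x in lam0. 0 < ennreal (dens B x) \<longrightarrow> good x \<and> pre n x \<in> B"
      using AE_good
    proof eventually_elim
      case (elim x)
      then show ?case using vv_zero[OF B, of "pre n x"] by (cases "pre n x \<in> B") (auto simp: dens_def)
    qed
  qed measurable
  then show ?thesis by (subst lamB_eq_density[OF B])
qed

text \<open>Birkhoff averages of cylinder functions converge to constants, and an invariant set may be
  moved along the orbit for free; hence it is independent of every cylinder, and so of itself.\<close>

lemma ergodic_lamB: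
  assumes B: "terminal_basic B"
  shows "ergodic g (LB B)"
  unfolding ergodic_def
proof (intro ballI impI)
  interpret prob_space "LB B" by (rule prob_space_lamB[OF B])
  note [simp] = sets_lamB[OF B] space_lamB[OF B]
  fix A assume "A \<in> sets (LB B)" and inv: "g -` A \<inter> space (LB B) = A"
  then have A [measurable]: "A \<in> sets lam0" by simp
  have gA: "g x \<in> A \<longleftrightarrow> x \<in> A" for x using inv by auto
  have gA': "(g ^^ i) x \<in> A \<longleftrightarrow> x \<in> A" for i x
    by (induction i) (auto simp: gA)
  have cyl: "(\<integral>x. indicator A x * \<phi> (pre m x) \<partial>LB B) = prob A * (\<integral>x. \<phi> (pre m x) \<partial>LB B)"
    for m and \<phi> :: "'a list \<Rightarrow> real"
  proof -
    obtain C where C: "\<And>x. \<bar>\<phi> (pre m x)\<bar> \<le> C" using bounded_on_pre[of \<phi> m] by auto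
    let ?h = "\<lambda>x. indicator A x * \<phi> (pre m x)"
    let ?S = "\<lambda>N x. indicator A x * ((\<Sum>i<N. \<phi> (pre m ((g ^^ i) x))) / real N)"
    have hm [measurable]: "?h \<in> borel_measurable lam0" by measurable
    have hi: "integrable (LB B) (\<lambda>x. ?h ((g ^^ i) x))" for i
    proof (rule integrable_const_bound[where B=C])
      show "AE x in LB B. norm (?h ((g ^^ i) x)) \<le> C"
        using C abs_ge_zero[THEN order_trans, OF C] by (auto simp: indicator_def)
      show "(\<lambda>x. ?h ((g ^^ i) x)) \<in> borel_measurable (LB B)"
        unfolding measurable_lamB_cong[OF B] by measurable
    qed
    \<comment> \<open>Invariance of \<open>A\<close> allows the indicator to be evaluated at time
      \<open>i\<close> instead of time 0.\<close>
    have S_eq: "?S N x = (\<Sum>i<N. ?h ((g ^^ i) x)) / real N" for N x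
      by (simp add: indicator_def gA' sum_distrib_left)
    have "(\<integral>x. ?S N x \<partial>LB B) = (\<integral>x. ?h x \<partial>LB B)" if "0 < N" for N
    proof -
      have "(\<integral>x. ?S N x \<partial>LB B) = (\<Sum>i<N. \<integral>x. ?h ((g ^^ i) x) \<partial>LB B) / real N"
        by (simp only: S_eq integral_divide_zero Bochner_Integration.integral_sum[OF hi])
      also have "\<dots> = (\<integral>x. ?h x \<partial>LB B)"
        using that by (simp only: integral_lamB_g_pow[OF B hm]) simp
      finally show ?thesis .
    qed
    then have "(\<lambda>N. \<integral>x. ?S N x \<partial>LB B) \<longlonglongrightarrow> (\<integral>x. ?h x \<partial>LB B)"
      by (intro tendsto_eventually eventually_sequentiallyI[of 1]) auto
    moreover have "(\<lambda>N. \<integral>x. ?S N x \<partial>LB B) \<longlonglongrightarrow> (\<integral>x. indicator A x * (\<integral>y. \<phi> (pre m y) \<partial>LB B) \<partial>LB B)"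
    proof (rule integral_dominated_convergence[where w="\<lambda>_. C"])
      show "AE x in LB B. (\<lambda>N. ?S N x) \<longlonglongrightarrow> indicator A x * (\<integral>y. \<phi> (pre m y) \<partial>LB B)"
        using AE_lamB[OF B]
      proof eventually_elim
        case (elim x)
        then show ?case
          using B by (intro tendsto_mult tendsto_const cylinder_average_lamB[of x B 0]) auto
      qed
      show "AE x in LB B. norm (?S N x) \<le> C" for N
      proof (rule AE_I2)
        fix x
        have "\<bar>\<Sum>i<N. \<phi> (pre m ((g ^^ i) x))\<bar> \<le> (\<Sum>i<N. C)"
          by (rule order_trans[OF sum_abs]) (intro sum_mono C)
        then have "\<bar>(\<Sum>i<N. \<phi> (pre m ((g ^^ i) x))) / real N\<bar> \<le> C"
          using abs_ge_zero[THEN order_trans, OF C] by (cases "N = 0") (auto simp: field_simps)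
        then show "norm (?S N x) \<le> C"
          using abs_ge_zero[THEN order_trans, OF C] by (auto simp: indicator_def)
      qed
      show "(\<lambda>x. ?S N x) \<in> borel_measurable (LB B)" for N
        unfolding measurable_lamB_cong[OF B] by measurable
      show "(\<lambda>x. indicator A x * (\<integral>y. \<phi> (pre m y) \<partial>LB B)) \<in> borel_measurable (LB B)"
        unfolding measurable_lamB_cong[OF B] by measurable
    qed simp
    ultimately have "(\<integral>x. ?h x \<partial>LB B) = (\<integral>x. indicator A x * (\<integral>y. \<phi> (pre m y) \<partial>LB B) \<partial>LB B)"
      by (rule LIMSEQ_unique)
    then show ?thesis using A by simp
  qed
  \<comment> \<open>The restriction of the measure to \<open>A\<close> is compared with its multiple
    by the mass of \<open>A\<close>; the identity \<open>cyl\<close> yields their agreement on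
    cylinders.\<close>
  let ?P = "density (LB B) (indicator A)" and ?Q = "scale_measure (emeasure (LB B) A) (LB B)"
  have Ai: "(indicator A :: _ \<Rightarrow> ennreal) \<in> borel_measurable (LB B)"
    unfolding measurable_lamB_cong[OF B] by measurable
  have P: "emeasure ?P Y = emeasure (LB B) (A \<inter> Y)" if "Y \<in> sets lam0" for Y
  proof -
    have "emeasure ?P Y = (\<integral>\<^sup>+x. indicator A x * indicator Y x \<partial>LB B)"
      by (rule emeasure_density) (use Ai that in auto)
    also have "\<dots> = emeasure (LB B) (A \<inter> Y)"
      using A that by (simp flip: indicator_inter_arith)
    finally show ?thesis .
  qed
  have "?P = ?Q"
  proof (rule measure_eqI_PiM_infinite[where I=UNIV and M="\<lambda>_. count_space UNIV"])
    show "sets ?P = sets (PiM UNIV (\<lambda>_. count_space UNIV))" "sets ?Q = sets (PiM UNIV (\<lambda>_. count_space UNIV))"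
      by (simp_all add: sets_lam0)
    show "finite_measure ?P"
      by (rule finite_measureI) (use P[of UNIV] sets.top[of "LB B"] in \<open>simp add: emeasure_eq_measure\<close>)
  next
    fix E :: "nat \<Rightarrow> 'a set" and J :: "nat set" assume J: "finite J"
    let ?X = "prod_emb UNIV (\<lambda>_. count_space UNIV) J (Pi\<^sub>E J E)"
    have X: "?X = {x. \<forall>j\<in>J. x j \<in> E j}"
      by (auto simp: prod_emb_def restrict_def PiE_def Pi_def extensional_def)
    obtain m where m: "\<And>j. j \<in> J \<Longrightarrow> j < m"
      using J unfolding finite_nat_set_iff_bounded by blast
    define \<phi> where "\<phi> w = (of_bool (\<forall>j\<in>J. w ! j \<in> E j) :: real)" for w
    have \<phi>: "\<phi> (pre m x) = indicator ?X x" for x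
      using m by (auto simp: \<phi>_def X indicator_def)
    have Xm [measurable]: "?X \<in> sets lam0"
      unfolding sets_lam0 using J by (intro sets_PiM_I) auto
    have "prob (A \<inter> ?X) = (\<integral>x. indicator A x * indicator ?X x \<partial>LB B)"
      using A Xm by (simp flip: indicator_inter_arith)
    also have "\<dots> = prob A * prob ?X"
      using cyl[of \<phi> m] Xm unfolding \<phi> by simp
    finally have "emeasure (LB B) (A \<inter> ?X) = emeasure (LB B) A * emeasure (LB B) ?X"
      by (simp add: emeasure_eq_measure ennreal_mult)
    then show "emeasure ?P ?X = emeasure ?Q ?X" using P[OF Xm] by simp
  qed
  \<comment> \<open>Evaluated at \<open>A\<close> itself, the equality makes the mass of
    \<open>A\<close> equal to its own square.\<close>
  then have "emeasure ?P A = emeasure ?Q A" by simp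
  moreover have "emeasure ?P A = emeasure (LB B) A"
    using P[OF A] by simp
  ultimately have "emeasure (LB B) A * emeasure (LB B) A = emeasure (LB B) A" by simp
  then have "prob A * prob A = prob A"
    by (simp add: emeasure_eq_measure flip: ennreal_mult)
  then have "prob A = 0 \<or> prob A = 1" by simp
  then show "emeasure (LB B) A = 0 \<or> emeasure (LB B) A = 1"
    by (auto simp: emeasure_eq_measure)
qed

end

section \<open>Topology of the sequence space\<close>

text \<open>Comparison with an infimum becomes existence of a long enough common prefix; the metric
  is afterwards handled through prefixes.\<close>

lemma dX_less_iff: "dX x y < e \<longleftrightarrow> (\<exists>k. pre k x = pre k y \<and> 1 / real (k + 1) < e)"
proof -
  have "bdd_below {1 / real (k + 1) | k. \<forall>i<k. x i = y i}"
    by (intro bdd_belowI[of _ 0]) auto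
  moreover have "{1 / real (k + 1) | k. \<forall>i<k. x i = y i} \<noteq> {}"
    by (auto intro: exI[of _ 0])
  ultimately show ?thesis
    unfolding dX_def by (subst cInf_less_iff) (auto simp: pre_eq_iff)
qed

lemma dX_nonneg: "0 \<le> dX x y"
  using dX_less_iff[of x y 0] by (auto simp: not_less[symmetric])

lemma dX_less_imp_pre_eq:
  assumes "dX x y < 1 / real m" "0 < m"
  shows "pre m x = pre m y"
proof -
  obtain k where k: "pre k x = pre k y" "1 / real (k + 1) < 1 / real m"
    using assms(1) unfolding dX_less_iff by blast
  \<comment> \<open>The bound means \<open>m < k + 1\<close>, so a strict bound by
    \<open>1 / m\<close> already gives \<open>m\<close> common letters.\<close>
  then have "m \<le> k" using assms(2) by (simp add: field_simps)
  with k(1) show ?thesis by (rule pre_eq_mono)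
qed

lemma dX_less_of_pre_eq: "pre m x = pre m y \<Longrightarrow> 1 / real (m + 1) < e \<Longrightarrow> dX x y < e"
  unfolding dX_less_iff by blast

lemma ex_inverse_less: "0 < e \<Longrightarrow> \<exists>m\<ge>l. 1 / real (m + 1) < e"
proof -
  assume "0 < e"
  then obtain m where m: "1 / real (m + 1) < e"
    using reals_Archimedean[of e] by (auto simp: inverse_eq_divide)
  have "1 / real (max l m + 1) \<le> 1 / real (m + 1)"
    by (intro divide_left_mono) auto
  with m show ?thesis by (intro exI[of _ "max l m"]) auto
qed

interpretation X: Metric_space UNIV "dX :: (nat \<Rightarrow> 'a) \<Rightarrow> _"
proof
  fix x y z :: "nat \<Rightarrow> 'a"
  show "0 \<le> dX x y" by (rule dX_nonneg)
  show "dX x y = dX y x" by (simp add: dX_def eq_commute)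
  show "dX x y = 0 \<longleftrightarrow> x = y"
  proof
    assume "dX x y = 0"
    then have "pre (Suc i) x = pre (Suc i) y" for i
      by (intro dX_less_imp_pre_eq) auto
    then show "x = y" by (auto simp: pre_eq_iff)
  next
    assume "x = y"
    have "\<not> 0 < dX x y"
    proof
      assume "0 < dX x y"
      then obtain m where "1 / real (m + 1) < dX x y" using ex_inverse_less[of _ 0] by blast
      then show False using dX_less_of_pre_eq[of m x y] \<open>x = y\<close> by blast
    qed
    then show "dX x y = 0" using dX_nonneg[of x y] by linarith
  qed
  show "dX x z \<le> dX x y + dX y z"
  proof (rule field_le_epsilon)
    fix e :: real assume e: "0 < e"
    obtain k where k: "pre k x = pre k y" "1 / real (k + 1) < dX x y + e / 2"
      using dX_less_iff[of x y "dX x y + e / 2"] e by auto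
    obtain l where l: "pre l y = pre l z" "1 / real (l + 1) < dX y z + e / 2"
      using dX_less_iff[of y z "dX y z + e / 2"] e by auto
    have "pre (min k l) x = pre (min k l) z"
      using k(1) l(1) by (auto simp: pre_eq_iff)
    moreover have "1 / real (min k l + 1) < dX x y + dX y z + e"
      using k(2) l(2) dX_nonneg[of x y] dX_nonneg[of y z] e by (auto simp: min_def)
    ultimately have "dX x z < dX x y + dX y z + e" by (rule dX_less_of_pre_eq)
    then show "dX x z \<le> dX x y + dX y z + e" by simp
  qed
qed

lemma topspace_Xtop [simp]: "topspace Xtop = UNIV"
  by (simp add: Xtop_def)

text \<open>Balls and cylinders refine each other: a ball of radius \<open>1 / Suc m\<close> lies in
  the cylinder of length \<open>m\<close>, and a long enough cylinder lies in a given ball.\<close>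

lemma openin_Xtop: "openin Xtop U \<longleftrightarrow> (\<forall>x\<in>U. \<exists>m. \<forall>y. pre m y = pre m x \<longrightarrow> y \<in> U)"
  unfolding Xtop_def X.openin_mtopology
proof (intro iffI conjI allI ballI impI)
  fix x assume "U \<subseteq> UNIV \<and> (\<forall>x. x \<in> U \<longrightarrow> (\<exists>r>0. X.mball x r \<subseteq> U))" "x \<in> U"
  then obtain r where r: "r > 0" "X.mball x r \<subseteq> U" by blast
  obtain m where "1 / real (m + 1) < r" using ex_inverse_less[OF r(1), of 0] by blast
  then have "y \<in> U" if "pre m y = pre m x" for y
    using dX_less_of_pre_eq[of m x y r] that r(2) by (auto simp: X.mball_def)
  then show "\<exists>m. \<forall>y. pre m y = pre m x \<longrightarrow> y \<in> U" by blast
next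
  fix x assume "\<forall>x\<in>U. \<exists>m. \<forall>y. pre m y = pre m x \<longrightarrow> y \<in> U" "x \<in> U"
  then obtain m where m: "\<And>y. pre m y = pre m x \<Longrightarrow> y \<in> U" by blast
  have "X.mball x (1 / real (Suc m)) \<subseteq> U"
  proof
    fix y assume "y \<in> X.mball x (1 / real (Suc m))"
    then have "pre (Suc m) x = pre (Suc m) y" by (intro dX_less_imp_pre_eq) auto
    then have "pre m x = pre m y" by (rule pre_eq_mono) simp
    then show "y \<in> U" using m by simp
  qed
  then show "\<exists>r>0. X.mball x r \<subseteq> U" by (intro exI[of _ "1 / real (Suc m)"]) auto
qed simp

lemma openin_cylinder: "openin Xtop {x. P (pre m x)}"
  unfolding openin_Xtop by (intro ballI exI[of _ m]) simp

text \<open>Koenig's lemma: a word none of whose extensions to a fixed length force the property has a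
  one-letter prolongation of the same kind.\<close>

lemma Koenig_prefix:
  fixes P :: "'a::finite list \<Rightarrow> bool"
  assumes hit: "\<And>x. \<exists>m. P (pre m x)" and ext: "\<And>v w. P v \<Longrightarrow> P (v @ w)"
  shows "\<exists>M. \<forall>x. P (pre M x)"
proof (rule ccontr)
  \<comment> \<open>A word is bad if no single length makes \<open>P\<close> hold for all sequences
    starting with it.\<close>
  define bad where "bad w \<longleftrightarrow> (\<forall>M. \<exists>y. \<not> P (pre M (conc w y)))" for w
  have mono: "P (pre M x)" if "P (pre m x)" "m \<le> M" for m M x
    using ext[OF that(1), of "drop m (pre M x)"] that(2) append_take_drop_id[of m "pre M x"]
    by (simp add: min_def split: if_splits)
  assume "\<not> ?thesis"
  then have bad0: "bad []" by (auto simp: bad_def conc_def)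
  have bad_step: "\<exists>a. bad (w @ [a])" if "bad w" for w
  proof (rule ccontr)
    assume "\<nexists>a. bad (w @ [a])"
    then have "\<forall>a. \<exists>M. \<forall>y. P (pre M (conc (w @ [a]) y))" by (simp add: bad_def)
    then obtain M where M: "\<And>a y. P (pre (M a) (conc (w @ [a]) y))" by metis
    \<comment> \<open>Finiteness of the alphabet enters here: the maximum of the lengths found for
      the single letters works for all of them.\<close>
    have "P (pre (Max (range M)) (conc w y))" for y
    proof -
      have "conc [y 0] (\<lambda>i. y (Suc i)) = y" by (auto simp: conc_def)
      then have "conc (w @ [y 0]) (\<lambda>i. y (Suc i)) = conc w y" by (simp add: conc_append)
      then have "P (pre (M (y 0)) (conc w y))" using M by metis
      then show ?thesis by (rule mono) (auto intro: Max_ge)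
    qed
    then show False using that by (auto simp: bad_def)
  qed
  define W where "W = rec_nat [] (\<lambda>_ w. w @ [SOME a. bad (w @ [a])])"
  have W0: "W 0 = []" and WS: "W (Suc i) = W i @ [SOME a. bad (W i @ [a])]" for i
    by (simp_all add: W_def)
  have badW: "bad (W i)" for i
  proof (induction i)
    case (Suc i)
    from someI_ex[OF bad_step[OF this]] show ?case by (simp add: WS)
  qed (simp add: W0 bad0)
  have lenW: "length (W i) = i" for i by (induction i) (auto simp: W0 WS)
  \<comment> \<open>The words \<open>W i\<close> are nested and \<open>x\<close> is their common
    limit; a prefix of \<open>x\<close> with property \<open>P\<close> would be a bad word, a
    contradiction.\<close>
  define x where "x i = W (Suc i) ! i" for i
  have "pre i x = W i" for i
  proof (induction i)
    case (Suc i)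
    have "pre (Suc i) x = pre i x @ [x i]" by (simp add: pre_def)
    moreover have "x i = (SOME a. bad (W i @ [a]))" by (simp add: x_def WS lenW nth_append)
    ultimately show ?case using Suc by (simp only: WS)
  qed (simp add: pre_def W0)
  then obtain m where "P (W m)" using hit[of x] by auto
  moreover have "pre m (conc (W m) y) = W m" for y using pre_conc_same[of "W m" y] lenW by simp
  ultimately show False using badW[of m] unfolding bad_def by metis
qed

text \<open>Continuity makes \<open>u\<close> oscillate by less than \<open>e\<close> on some
  cylinder around each point, and Koenig's lemma makes the length uniform. This is uniform
  continuity on a compact space, in terms of prefixes.\<close>

lemma continuous_uniform_prefix:
  fixes u :: "(nat \<Rightarrow> 'a::finite) \<Rightarrow> real"
  assumes u: "continuous_map Xtop euclideanreal u" and e: "0 < e"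
  shows "\<exists>m. \<forall>x y. pre m x = pre m y \<longrightarrow> \<bar>u x - u y\<bar> < e"
proof -
  define P where "P w \<longleftrightarrow> (\<forall>y z. \<bar>u (conc w y) - u (conc w z)\<bar> < e)" for w
  have "\<exists>M. \<forall>x. P (pre M x)"
  proof (rule Koenig_prefix)
    fix x
    have "openin Xtop {y \<in> topspace Xtop. u y \<in> ball (u x) (e / 2)}"
      by (rule openin_continuous_map_preimage[OF u]) simp
    moreover have "x \<in> {y \<in> topspace Xtop. u y \<in> ball (u x) (e / 2)}" using e by simp
    ultimately obtain m where m: "\<And>y. pre m y = pre m x \<Longrightarrow> u y \<in> ball (u x) (e / 2)"
      unfolding openin_Xtop by blast
    have "\<bar>u (conc (pre m x) y) - u (conc (pre m x) z)\<bar> < e" for y z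
      using m[of "conc (pre m x) y"] m[of "conc (pre m x) z"] e
      by (auto simp: pre_conc_le dist_real_def abs_less_iff abs_if split: if_splits)
    then show "\<exists>m. P (pre m x)" by (auto simp: P_def)
  next
    fix v w assume "P v" then show "P (v @ w)" by (simp add: P_def conc_append)
  qed
  then obtain M where M: "\<And>x. P (pre M x)" by blast
  have "\<bar>u x - u y\<bar> < e" if "pre M x = pre M y" for x y
  proof -
    have "\<bar>u (conc (pre M x) (\<lambda>i. x (M + i))) - u (conc (pre M x) (\<lambda>i. y (M + i)))\<bar> < e"
      using M[of x] by (simp add: P_def)
    moreover have "conc (pre M x) (\<lambda>i. y (M + i)) = y"
      unfolding that by (rule conc_pre_shift)
    ultimately show ?thesis by (simp add: conc_pre_shift)
  qed
  then show ?thesis by blast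
qed

text \<open>\<open>u\<close> is the pointwise limit of cylinder functions, obtained by replacing
  ever later tails by a fixed sequence \<open>c\<close>.\<close>

lemma borel_measurable_continuous_Xtop:
  fixes u :: "(nat \<Rightarrow> 'a::finite) \<Rightarrow> real"
  assumes u: "continuous_map Xtop euclideanreal u"
  shows "u \<in> borel_measurable lam0"
proof -
  define c :: "nat \<Rightarrow> 'a" where "c = undefined"
  have "\<exists>m. \<forall>x y. pre m x = pre m y \<longrightarrow> \<bar>u x - u y\<bar> < 1 / real (Suc j)" for j
    by (rule continuous_uniform_prefix[OF u]) simp
  then obtain m where m: "\<And>j x y. pre (m j) x = pre (m j) y \<Longrightarrow> \<bar>u x - u y\<bar> < 1 / real (Suc j)"
    by metis
  show ?thesis
  proof (rule borel_measurable_LIMSEQ_metric)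
    show "(\<lambda>x. u (conc (pre (m j) x) c)) \<in> borel_measurable lam0" for j by measurable
    fix x
    show "(\<lambda>j. u (conc (pre (m j) x) c)) \<longlonglongrightarrow> u x"
    proof (rule LIM_zero_cancel, rule Lim_null_comparison[OF _ LIMSEQ_Suc[OF lim_const_over_n[of 1]]])
      show "\<forall>\<^sub>F j in sequentially. norm (u (conc (pre (m j) x) c) - u x) \<le> 1 / real (Suc j)"
        by (intro always_eventually allI) (use m[THEN less_imp_le] in \<open>auto simp: pre_conc_le\<close>)
    qed
  qed
qed

section \<open>Genericity and supports of the limit measures\<close>

context shift_like
begin

text \<open>Uniform approximation by a cylinder function moves both the averages and the integral by
  at most \<open>e\<close>; the cylinder case supplies the remaining third of
  \<open>r\<close>.\<close>

lemma continuous_average_lamB: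
  fixes u :: "(nat \<Rightarrow> 'a) \<Rightarrow> real"
  assumes x: "good x" and B: "terminal_basic B" and ent: "pre n ((g ^^ i0) x) \<in> B"
    and u: "continuous_map Xtop euclideanreal u"
  shows "(\<lambda>N. (\<Sum>i<N. u ((g ^^ i) x)) / real N) \<longlonglongrightarrow> (\<integral>y. u y \<partial>LB B)"
proof (rule LIMSEQ_I)
  fix r :: real assume "0 < r"
  interpret prob_space "LB B" by (rule prob_space_lamB[OF B])
  have um: "u \<in> borel_measurable (LB B)"
    unfolding measurable_lamB_cong[OF B] by (rule borel_measurable_continuous_Xtop[OF u])
  let ?A = "\<lambda>f N. (\<Sum>i<N. f ((g ^^ i) x)) / real N"
  define e where "e = r / 3"
  have e: "0 < e" using \<open>0 < r\<close> by (simp add: e_def)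
  obtain m where m: "\<And>x y. pre m x = pre m y \<Longrightarrow> \<bar>u x - u y\<bar> < e"
    using continuous_uniform_prefix[OF u e] by blast
  define \<phi> where "\<phi> w = u (conc w undefined)" for w
  have \<phi>: "\<bar>u y - \<phi> (pre m y)\<bar> \<le> e" for y
    unfolding \<phi>_def by (intro less_imp_le m) (simp add: pre_conc_le)
  obtain C where C: "\<And>x. \<bar>\<phi> (pre m x)\<bar> \<le> C" using bounded_on_pre[of \<phi> m] by auto
  have int\<phi>: "integrable (LB B) (\<lambda>y. \<phi> (pre m y))"
  proof (rule integrable_const_bound[where B=C])
    show "(\<lambda>y. \<phi> (pre m y)) \<in> borel_measurable (LB B)"
      unfolding measurable_lamB_cong[OF B] by measurable
  qed (use C in auto)
  have uC: "\<bar>u y\<bar> \<le> C + e" for y using \<phi>[of y] C[of y] by linarith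
  have intu: "integrable (LB B) u"
    by (rule integrable_const_bound[where B="C + e"]) (use uC um in auto)
  have int_close: "\<bar>(\<integral>y. u y \<partial>LB B) - (\<integral>y. \<phi> (pre m y) \<partial>LB B)\<bar> \<le> e"
  proof -
    have "\<bar>\<integral>y. u y - \<phi> (pre m y) \<partial>LB B\<bar> \<le> (\<integral>y. \<bar>u y - \<phi> (pre m y)\<bar> \<partial>LB B)"
      by (rule integral_abs_bound)
    also have "\<dots> \<le> e"
      by (rule integral_le_const) (use intu int\<phi> \<phi> in auto)
    finally show ?thesis using intu int\<phi> by simp
  qed
  have av_close: "\<bar>?A u N - ?A (\<lambda>y. \<phi> (pre m y)) N\<bar> \<le> e" for N
  proof -
    have "\<bar>\<Sum>i<N. u ((g ^^ i) x) - \<phi> (pre m ((g ^^ i) x))\<bar> \<le> (\<Sum>i<N. e)"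
      by (rule order_trans[OF sum_abs]) (intro sum_mono \<phi>)
    then have "\<bar>(\<Sum>i<N. u ((g ^^ i) x) - \<phi> (pre m ((g ^^ i) x))) / real N\<bar> \<le> e"
      using e by (cases "N = 0") (auto simp: field_simps)
    then show ?thesis by (simp add: sum_subtractf diff_divide_distrib)
  qed
  obtain N0 where N0: "\<And>N. N \<ge> N0 \<Longrightarrow> norm (?A (\<lambda>y. \<phi> (pre m y)) N - (\<integral>y. \<phi> (pre m y) \<partial>LB B)) < e"
    using LIMSEQ_D[OF cylinder_average_lamB[OF x B ent, of \<phi> m] e] by blast
  have "norm (?A u N - (\<integral>y. u y \<partial>LB B)) < r" if "N \<ge> N0" for N
  proof -
    have "\<bar>?A (\<lambda>y. \<phi> (pre m y)) N - (\<integral>y. \<phi> (pre m y) \<partial>LB B)\<bar> < e"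
      using N0[OF that] by simp
    then show ?thesis using av_close[of N] int_close unfolding e_def real_norm_def by linarith
  qed
  then have "\<forall>N\<ge>N0. norm (?A u N - (\<integral>y. u y \<partial>LB B)) < r"
    by simp
  then show "\<exists>N0. \<forall>N\<ge>N0. norm (?A u N - (\<integral>y. u y \<partial>LB B)) < r" ..
qed

lemma generic_lamB:
  assumes "good x" and "terminal_basic B" and "pre n ((g ^^ i0) x) \<in> B"
  shows "generic Xtop g (LB B) x"
  unfolding generic_def by (intro allI impI) (rule continuous_average_lamB[OF assms])

text \<open>An open set is a union of cylinders, and there are only countably many of these because
  words over a finite alphabet are countable.\<close>

lemma openin_Xtop_sets:
  fixes U :: "(nat \<Rightarrow> 'a) set"
  assumes "openin Xtop U"
  shows "U \<in> sets lam0"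
proof -
  let ?S = "{p. {y. pre (fst p) y = snd p} \<subseteq> U}"
  have "U = (\<Union>p\<in>?S. {y. pre (fst p) y = snd p})"
  proof (intro equalityI subsetI)
    fix x assume "x \<in> U"
    then obtain m where "\<And>y. pre m y = pre m x \<Longrightarrow> y \<in> U"
      using assms unfolding openin_Xtop by blast
    then have "(m, pre m x) \<in> ?S" by auto
    then show "x \<in> (\<Union>p\<in>?S. {y. pre (fst p) y = snd p})" by (rule UN_I) simp
  qed auto
  also have "\<dots> \<in> sets lam0"
    by (rule sets.countable_UN'') (auto intro: sets_cylinder countable_subset[OF subset_UNIV])
  finally show ?thesis .
qed

lemma emeasure_lamB_cylinder:
  assumes B: "terminal_basic B" and "n \<le> m"
  shows "emeasure (LB B) {y. pre m y = pre m x} = ennreal (dens B x / real CARD('a) ^ m)"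
proof -
  interpret prob_space "lam0 :: (nat \<Rightarrow> 'a) measure" by (rule prob_space_lam0)
  have "emeasure (LB B) {y. pre m y = pre m x}
      = (\<integral>\<^sup>+y. ennreal (dens B y) * indicator {y. pre m y = pre m x} y \<partial>lam0)"
    unfolding lamB_eq_density[OF B] by (intro emeasure_density sets_cylinder) measurable
  also have "\<dots> = (\<integral>\<^sup>+y. ennreal (dens B x) * indicator {y. pre m y = pre m x} y \<partial>lam0)"
  proof (intro nn_integral_cong)
    fix y
    have "dens B y = dens B x" if "pre m y = pre m x"
      using pre_eq_mono[OF that \<open>n \<le> m\<close>] by (simp add: dens_def)
    then show "ennreal (dens B y) * indicator {y. pre m y = pre m x} y =
        ennreal (dens B x) * indicator {y. pre m y = pre m x} y"
      by (auto simp: indicator_def)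
  qed
  also have "\<dots> = ennreal (dens B x) * emeasure lam0 {y. pre m y = pre m x}"
    by (intro nn_integral_cmult_indicator sets_cylinder)
  also have "\<dots> = ennreal (dens B x) * ennreal (1 / real CARD('a) ^ m)"
    by (simp add: emeasure_eq_measure measure_pre_eq)
  finally show ?thesis by (simp add: dens_nonneg[OF B] flip: ennreal_mult)
qed

text \<open>The density is positive exactly over \<open>B\<close>, and each neighbourhood contains a
  cylinder of length at least \<open>n\<close>, on which the density is constant.\<close>

lemma msupport_lamB:
  assumes B: "terminal_basic B"
  shows "msupport Xtop (LB B) = {x. pre n x \<in> B}"
proof (intro equalityI subsetI)
  fix x assume x: "x \<in> msupport Xtop (LB B)"
  have "openin Xtop {y. pre n y = pre n x}" by (rule openin_cylinder)
  then have "emeasure (LB B) {y. pre n y = pre n x} > 0"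
    using x by (auto simp: msupport_def)
  then have "0 < vv B (pre n x)"
    by (simp add: emeasure_lamB_cylinder[OF B] dens_def)
  then show "x \<in> {x. pre n x \<in> B}" by (simp add: vv_pos_iff[OF B])
next
  fix x assume x: "x \<in> {x. pre n x \<in> B}"
  have "emeasure (LB B) U > 0" if U: "openin Xtop U" "x \<in> U" for U
  proof -
    obtain m where m: "\<And>y. pre m y = pre m x \<Longrightarrow> y \<in> U"
      using U unfolding openin_Xtop by blast
    let ?C = "{y. pre (max n m) y = pre (max n m) x}"
    have "?C \<subseteq> U"
    proof
      fix y assume "y \<in> ?C"
      then have "pre (max n m) y = pre (max n m) x" by simp
      then have "pre m y = pre m x" by (rule pre_eq_mono) simp
      then show "y \<in> U" by (rule m)
    qed
    have "U \<in> sets (LB B)"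
      using openin_Xtop_sets[OF U(1)] by (simp add: sets_lamB[OF B])
    then have "emeasure (LB B) ?C \<le> emeasure (LB B) U"
      using \<open>?C \<subseteq> U\<close> by (rule emeasure_mono[rotated])
    moreover have "0 < emeasure (LB B) ?C"
      using x vv_pos_iff[OF B, of "pre n x"] by (simp add: emeasure_lamB_cylinder[OF B] dens_def)
    ultimately show ?thesis by simp
  qed
  then show "x \<in> msupport Xtop (LB B)" by (auto simp: msupport_def)
qed

text \<open>A preimage of \<open>x\<close> is the sequence of orbit prefixes of length
  \<open>n + k\<close>; terminality keeps them in the associated class. Conversely, the first
  \<open>n\<close> letters of an image point come from the word at index 0, whose initial part lies
  in \<open>B\<close>.\<close>

lemma Hgam_image:
  assumes B: "terminal_basic B"
  shows "Hgam n k ` Bstar_seq n k \<gamma> B = {x. pre n x \<in> B}"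
proof (intro equalityI subsetI)
  fix x assume "x \<in> Hgam n k ` Bstar_seq n k \<gamma> B"
  then obtain ss where x: "x = Hgam n k ss" and ss: "length (ss 0) = n + k" "take n (ss 0) \<in> B"
    by (auto simp: Bstar_seq_def assoc_star_def Jn_def)
  have "pre n x = take n (ss 0)"
    unfolding x using ss(1) by (auto simp: pre_eq_list_iff Hgam_def)
  then show "x \<in> {x. pre n x \<in> B}" using ss by simp
next
  fix x assume "x \<in> {x. pre n x \<in> B}"
  then have in_B: "pre n ((g ^^ i) x) \<in> B" for i using terminal_basic_pow[OF B] by simp
  define ss where "ss i = pre (n + k) ((g ^^ i) x)" for i
  have \<gamma>_ss: "\<gamma> (ss i) = pre n ((g ^^ Suc i) x)" for i
    by (simp add: ss_def pre_g)
  have "ss \<in> Bstar_seq n k \<gamma> B"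
    using in_B[of "Suc _"] in_B
    by (auto simp: Bstar_seq_def Kstar_seq_def Gstar_def assoc_star_def \<gamma>_ss Jn_def simp del: funpow.simps)
      (auto simp: ss_def)
  moreover have "Hgam n k ss = x"
  proof
    fix i
    show "Hgam n k ss i = x i"
    proof (cases "i < n + k")
      case False
      \<comment> \<open>The word at index 0 fills the first \<open>n + k\<close> positions, so
        position \<open>i\<close> belongs to block \<open>Suc q\<close>; its letter is the one at
        position \<open>n + r\<close> of the orbit point at that time.\<close>
      define j q r where "j = i - (n + k)" and "q = j div k" and "r = j mod k"
      have r: "r < k" using k_pos by (simp add: r_def)
      have "Hgam n k ss i = (g ^^ Suc q) x (n + r)"
        using False r by (simp add: Hgam_def Jbar_def ss_def j_def q_def r_def del: funpow.simps)
      also have "\<dots> = x (n + r + Suc q * k)" by (rule g_pow_tail) simp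
      also have "n + r + Suc q * k = i"
        using False div_mult_mod_eq[of j k] by (simp add: j_def q_def r_def)
      finally show ?thesis .
    qed (simp add: Hgam_def ss_def)
  qed
  ultimately show "x \<in> Hgam n k ` Bstar_seq n k \<gamma> B" by (intro image_eqI[of _ _ ss]) simp_all
qed

end

section \<open>Chain recurrence\<close>

context shift_like
begin

definition chain_step :: "real \<Rightarrow> ((nat \<Rightarrow> 'a) \<times> (nat \<Rightarrow> 'a)) set" where
  "chain_step e = {(x, z). dX (g x) z < e}"

abbreviation "chain \<equiv> chain_rel dX g"

lemma chain_iff: "(x, y) \<in> chain \<longleftrightarrow> (\<forall>e>0. (x, y) \<in> (chain_step e)\<^sup>+)"
proof -
  have "{(x, g x) | x. True} O {(y, z). dX y z < e} = chain_step e" for e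
    by (auto simp: chain_step_def)
  then show ?thesis by (simp add: chain_rel_def)
qed

lemma chain_trans: "(x, y) \<in> chain \<Longrightarrow> (y, z) \<in> chain \<Longrightarrow> (x, z) \<in> chain"
  unfolding chain_iff by (blast intro: trancl_trans)

lemma basic_set_chain_iff:
  "basic_set chain C \<longleftrightarrow> (\<exists>x. (x, x) \<in> chain \<and> C = {y. (x, y) \<in> chain \<and> (y, x) \<in> chain})"
proof -
  have "chain\<^sup>+ = chain" by (intro trancl_id transI) (rule chain_trans)
  then show ?thesis by (simp add: basic_set_def)
qed

text \<open>Jumps smaller than \<open>1 / n\<close> leave the leading word of length
  \<open>n\<close> untouched, so a chain projects to a path of \<open>G\<close>.\<close>

lemma chain_step_pre:
  assumes "(x, y) \<in> (chain_step e)\<^sup>+" "e \<le> 1 / real n"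
  shows "(pre n x, pre n y) \<in> G\<^sup>+"
proof -
  have step: "(pre n x, pre n y) \<in> G" if "(x, y) \<in> chain_step e" for x y
  proof -
    have "pre n (g x) = pre n y"
      using that assms(2) n_pos by (intro dX_less_imp_pre_eq) (auto simp: chain_step_def)
    then show ?thesis using G_pre[of x] by simp
  qed
  from assms(1) show ?thesis
    by induction (auto dest: step intro: trancl_into_trancl)
qed

text \<open>A chain with small jumps shadows the orbit of its initial point for as long as desired, and a
  recurrent endpoint allows the chain to be prolonged past that time.\<close>

lemma chain_step_shadow:
  assumes "(x, y) \<in> (chain_step e)\<^sup>+" and y: "(y, y) \<in> (chain_step e)\<^sup>+"
    and "e \<le> 1 / real (n + i * k)"
  shows "(pre n ((g ^^ i) x), pre n y) \<in> G\<^sup>+"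
  using assms(1,3)
proof (induction i arbitrary: x)
  case 0
  then show ?case using chain_step_pre[of x y e] by simp
next
  case (Suc i)
  obtain z where z: "(x, z) \<in> chain_step e" "(z, y) \<in> (chain_step e)\<^sup>*"
    using tranclD[OF Suc.prems(1)] by blast
  \<comment> \<open>If the chain already ends at \<open>z = y\<close>, the recurrence of
    \<open>y\<close> provides further steps.\<close>
  have zy: "(z, y) \<in> (chain_step e)\<^sup>+"
    using z(2) y by (rule rtrancl_trancl_trancl)
  have e: "e \<le> 1 / real (n + i * k)"
    using Suc.prems(2) by (rule order_trans) (use n_pos in \<open>auto intro!: divide_left_mono simp del: of_nat_add of_nat_mult\<close>)
  have "pre (n + i * k) (g x) = pre (n + i * k) z"
    using z(1) e n_pos by (intro dX_less_imp_pre_eq) (auto simp: chain_step_def)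
  then have "pre n ((g ^^ i) (g x)) = pre n ((g ^^ i) z)"
    by (rule pre_g_pow_cong[rotated]) simp
  then show ?case
    using Suc.IH[OF zy e] by (simp add: funpow_Suc_right del: funpow.simps)
qed

lemma chain_recurrent_pre:
  assumes "(x, x) \<in> chain"
  shows "(pre n ((g ^^ i) x), pre n x) \<in> G\<^sup>+"
proof -
  have "(x, x) \<in> (chain_step (1 / real (n + i * k)))\<^sup>+"
    using assms n_pos unfolding chain_iff by (simp del: of_nat_add)
  then show ?thesis using chain_step_shadow by blast
qed

lemma chain_pre: "(x, y) \<in> chain \<Longrightarrow> (pre n x, pre n y) \<in> G\<^sup>+"
  using chain_step_pre[of x y "1 / real n"] n_pos by (simp add: chain_iff)

text \<open>Each edge of \<open>G\<close> is realised by a choice of \<open>k\<close> letters;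
  appended to one another, these letters steer the orbit along the path while the tail stays
  free.\<close>

lemma G_path_conc:
  assumes "(s, t) \<in> G\<^sup>+"
  shows "\<exists>p w. \<forall>y. (g ^^ p) (conc (s @ w) y) = conc t y"
  using assms
proof induction
  case (base t)
  then obtain w where w: "length s = n" "length w = k" "t = \<gamma> (s @ w)" by (auto simp: Grel_iff)
  then have "\<forall>y. (g ^^ 1) (conc (s @ w) y) = conc t y" by (simp add: g_conc)
  then show ?case by blast
next
  case (step t t')
  then obtain p w where pw: "\<And>y. (g ^^ p) (conc (s @ w) y) = conc t y" by blast
  from step obtain v where v: "length t = n" "length v = k" "t' = \<gamma> (t @ v)" by (auto simp: Grel_iff)
  have "(g ^^ Suc p) (conc (s @ (w @ v)) y) = conc t' y" for y
  proof -
    have "(g ^^ Suc p) (conc (s @ (w @ v)) y) = g (conc (t @ v) y)"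
      using pw[of "conc v y"] by (simp add: conc_append)
    then show ?thesis using v by (simp add: g_conc)
  qed
  then show ?case by blast
qed

lemma chain_step_orbit: "0 < e \<Longrightarrow> (x, (g ^^ i) x) \<in> (chain_step e)\<^sup>*"
proof (induction i)
  case (Suc i)
  then have "((g ^^ i) x, (g ^^ Suc i) x) \<in> chain_step e" by (simp add: chain_step_def)
  with Suc show ?case by (meson rtrancl.rtrancl_into_rtrancl)
qed simp

text \<open>After one small jump far to the right, the remaining letters are free: they can be chosen so
  that the orbit lands exactly on the target.\<close>

lemma chain_connect:
  assumes reach: "\<And>i. (pre n ((g ^^ i) x), pre n y) \<in> G\<^sup>+"
  shows "(x, y) \<in> chain"
  unfolding chain_iff
proof (intro allI impI)
  fix e :: real assume e: "0 < e"
  obtain q where q: "1 / real (q + 1) < e" using ex_inverse_less[OF e, of 0] by blast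
  obtain p w where pw: "\<And>y'. (g ^^ p) (conc (pre n ((g ^^ Suc q) x) @ w) y') = conc (pre n y) y'"
    using G_path_conc[OF reach] by blast
  \<comment> \<open>\<open>w\<close> steers the orbit to the leading word of \<open>y\<close>, and
    behind it stands the tail of \<open>y\<close>; \<open>z\<close> keeps the letters of
    \<open>g x\<close> that govern its first \<open>q\<close> steps.\<close>
  define y' where "y' = conc w (\<lambda>i. y (n + i))"
  define z where "z = conc (pre (n + q * k) (g x)) y'"
  have "(g ^^ q) z = conc (pre n ((g ^^ Suc q) x)) y'"
    unfolding z_def g_pow_conc_pre by (simp add: funpow_Suc_right del: funpow.simps)
  then have "(g ^^ p) ((g ^^ q) z) = y"
    using pw by (simp add: y'_def conc_pre_shift flip: conc_append)
  then have "(z, y) \<in> (chain_step e)\<^sup>*"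
    using chain_step_orbit[OF e, of z "p + q"] by (simp add: funpow_add)
  moreover have "(x, z) \<in> chain_step e"
  proof -
    have "q \<le> n + q * k" using k_pos by (simp add: trans_le_add2)
    then have "pre q (g x) = pre q z" by (simp add: z_def pre_conc_le)
    then show ?thesis using dX_less_of_pre_eq q by (auto simp: chain_step_def)
  qed
  ultimately show "(x, y) \<in> (chain_step e)\<^sup>+" by (rule rtrancl_into_trancl2[rotated])
qed

text \<open>From a chain recurrent point, a \<open>G\<close>-path between leading words can be
  upgraded to a chain. So a class is determined by the leading word of any member, and there are
  finitely many such words.\<close>

lemma finite_chain_basic_sets: "finite {C. basic_set chain C}"
proof (rule finite_subset)
  let ?F = "\<lambda>s. {y. (y, y) \<in> chain \<and> (s, pre n y) \<in> G\<^sup>+ \<and> (pre n y, s) \<in> G\<^sup>+}"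
  show "{C. basic_set chain C} \<subseteq> ?F ` Kw n"
  proof
    fix C assume "C \<in> {C. basic_set chain C}"
    then obtain x where x: "(x, x) \<in> chain" and C: "C = {y. (x, y) \<in> chain \<and> (y, x) \<in> chain}"
      by (auto simp: basic_set_chain_iff)
    have conn: "(u, v) \<in> chain" if "(u, u) \<in> chain" "(pre n u, pre n v) \<in> G\<^sup>+" for u v
      using chain_recurrent_pre[OF that(1)] that(2) by (intro chain_connect) (rule trancl_trans)
    have "C = ?F (pre n x)"
    proof (intro equalityI subsetI)
      fix y assume "y \<in> C"
      then have "(x, y) \<in> chain" "(y, x) \<in> chain" by (auto simp: C)
      then show "y \<in> ?F (pre n x)" using chain_trans[of y x y] chain_pre by blast
    next
      fix y assume "y \<in> ?F (pre n x)"
      then show "y \<in> C" using conn[of x y] conn[of y x] x by (simp add: C)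
    qed
    then show "C \<in> ?F ` Kw n" by (intro image_eqI[of _ _ "pre n x"]) auto
  qed
qed simp

text \<open>The clopen set of points with leading word in \<open>B\<close> is forward invariant and
  any two of its points are chained, so it lies in one chain class. Being closed it contains the
  limit sets of its points, and being open it lies in the interior of the basin.\<close>

lemma lamB_visible:
  assumes B: "terminal_basic B"
  shows "\<exists>C. basic_set chain C \<and> visible Xtop g C \<and> msupport Xtop (LB B) \<subseteq> C"
proof -
  let ?D = "{x. pre n x \<in> B}"
  have conn: "(x, y) \<in> chain" if "x \<in> ?D" "y \<in> ?D" for x y
  proof (rule chain_connect)
    fix i
    have "pre n ((g ^^ i) x) \<in> B" using terminal_basic_pow[OF B] that by simp
    then have "G\<^sup>+ `` {pre n ((g ^^ i) x)} = B"
      using B by (intro terminal_basic_reach) (auto simp: terminal_basic_def)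
    then show "(pre n ((g ^^ i) x), pre n y) \<in> G\<^sup>+" using that by auto
  qed
  obtain s where s: "s \<in> B" using terminal_basic_nonempty[OF B] by auto
  then have "length s = n" using terminal_basic_subset[OF B] by auto
  then have "pre n (conc s undefined) = s" using pre_conc_same[of s] by simp
  with s have "conc s undefined \<in> ?D" by simp
  then obtain x where x: "x \<in> ?D" ..
  let ?C = "{y. (x, y) \<in> chain \<and> (y, x) \<in> chain}"
  have D: "?D \<subseteq> ?C" using conn x by auto
  have basic: "basic_set chain ?C"
    using conn[OF x x] unfolding basic_set_chain_iff by blast
  have closed: "closedin Xtop ?D"
    using openin_cylinder[of "\<lambda>w. w \<notin> B" n] by (simp add: closedin_def Compl_eq_Diff_UNIV[symmetric] Collect_neg_eq)
  have "omega_limit Xtop g y \<subseteq> ?C" if "y \<in> ?D" for y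
  proof -
    have "omega_limit Xtop g y \<subseteq> Xtop closure_of {(g ^^ i) y | i. 0 \<le> i}"
      unfolding omega_limit_def by (rule INT_lower) simp
    also have "\<dots> \<subseteq> ?D"
      using terminal_basic_pow[OF B] that by (intro closure_of_minimal[OF _ closed]) auto
    finally show ?thesis using D by blast
  qed
  then have "?D \<subseteq> Xtop interior_of {y \<in> topspace Xtop. omega_limit Xtop g y \<subseteq> ?C}"
    by (intro interior_of_maximal openin_cylinder) auto
  then have "visible Xtop g ?C" using x unfolding visible_def by blast
  then show ?thesis using basic D msupport_lamB[OF B] by auto
qed

section \<open>Assembly of the tractability conditions\<close>

lemma terminal_basic_disjoint:
  assumes "terminal_basic B" "terminal_basic B'" "B \<noteq> B'"
  shows "B \<inter> B' = {}"
proof (rule ccontr)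
  assume "B \<inter> B' \<noteq> {}"
  then obtain t where "t \<in> B" "t \<in> B'" by blast
  then have "G\<^sup>+ `` {t} = B" "G\<^sup>+ `` {t} = B'"
    using assms by (simp_all add: terminal_basic_def terminal_basic_reach)
  then show False using assms(3) by simp
qed

lemma tractable_lamB: "tractable Xtop dX g lam0 {B. terminal_basic B} LB"
  unfolding tractable_def
proof (intro conjI ballI impI)
  show "finite {C. basic_set chain C}" by (rule finite_chain_basic_sets)
  show "finite {B. terminal_basic B}"
    by (rule finite_subset[of _ "Pow (Kw n)"]) (use terminal_basic_subset in auto)
  show "AE x in lam0. \<exists>B\<in>{B. terminal_basic B}. generic Xtop g (LB B) x"
    using AE_good
  proof eventually_elim
    case (elim x)
    then obtain B i where "terminal_basic B" "pre n ((g ^^ i) x) \<in> B"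
      using good_enters_terminal by blast
    then show ?case using generic_lamB[OF elim] by blast
  qed
next
  fix B B' assume "B \<in> {B. terminal_basic B}" "B' \<in> {B. terminal_basic B}" "B \<noteq> B'"
  then have "msupport Xtop (LB B) \<inter> msupport Xtop (LB B') = {}"
    using terminal_basic_disjoint[of B B'] by (auto simp: msupport_lamB)
  then show "emeasure lam0 (msupport Xtop (LB B) \<inter> msupport Xtop (LB B')) = 0" by simp
qed (simp_all add: prob_space_lamB invariant_lamB ergodic_lamB lamB_visible)

end

theorem theorem5p5:
  fixes n k :: nat and \<gamma> :: "'a::finite list \<Rightarrow> 'a list"
  assumes "0 < n" and "0 < k"
    and "\<forall>s\<in>Kw (n+k). \<gamma> s \<in> Kw n"
  shows "(\<forall>B. basic_set (Grel n k \<gamma>) B \<and> terminal (Grel n k \<gamma>) B \<longrightarrow>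
            prob_space (lamB n k \<gamma> B) \<and>
            invariant_measure (shiftlike n k \<gamma>) (lamB n k \<gamma> B) \<and>
            ergodic (shiftlike n k \<gamma>) (lamB n k \<gamma> B) \<and>
            msupport Xtop (lamB n k \<gamma> B) = Hgam n k ` Bstar_seq n k \<gamma> B)
       \<and> tractable Xtop dX (shiftlike n k \<gamma>) lam0
           {B. basic_set (Grel n k \<gamma>) B \<and> terminal (Grel n k \<gamma>) B} (lamB n k \<gamma>)"
proof -
  interpret shift_like n k \<gamma>
    using assms by unfold_locales auto
  have terminal_basic: "basic_set (Grel n k \<gamma>) B \<and> terminal (Grel n k \<gamma>) B \<longleftrightarrow> terminal_basic B" for B
    by (simp add: terminal_basic_def)
  show ?thesis
    unfolding terminal_basic using tractable_lamB
    by (simp add: prob_space_lamB invariant_lamB ergodic_lamB msupport_lamB Hgam_image)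
qed

end
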